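(* Let $\mathcal{H}$ be a separable infinite-dimensional complex Hilbert space and let $(T_t)_{t \ge 0}$ be a $C_0$-semigroup on $\mathcal{H}$ such that for every $t > 0$, $T_t$ is pure and concave. Then there exist $r > 0$, a Hilbert space $E$, a reproducing kernel Hilbert space $\mathfrak{H}$ of holomorphic functions from $D(0,r)$ into $E$, and a unitary operator $U : \mathcal{H} \to \mathfrak{H}$ such that, for every $t \ge 0$, $$T_t = U^{-1} S_t U,$$ where $S_t$ is the bounded operator on $\mathfrak{H}$ given by $(S_t f)(z) = e^{t\frac{z+1}{z-1}} f(z)$.
   Context: A $C_0$-semigroup is a strongly continuous one-parameter semigroup of bounded operators. A bounded operator $T$ on $\mathcal{H}$ is pure if $\bigcap_{n \ge 0} T^n\mathcal{H} = \{0\}$, and concave if $T^{*2}T^2 - 2T^*T + \mathrm{Id} \le 0$, i.e. $\|T^2x\|^2 + \|x\|^2 \le 2\|Tx\|^2$ for all $x \in \mathcal{H}$. $D(0,r)$ is the open disc of $\mathbb{C}$ of centre $0$ and radius $r$. A Hilbert space $\mathfrak{H}$ of holomorphic functions on $D = D(0,r)$ with values in a Hilbert space $E$ is a reproducing kernel Hilbert space if there is a map $k : D\times D \to \mathcal{L}(E)$ (bounded operators on $E$) such that (1) for all $\lambda \in D$ and $e \in E$, $k(\lambda,\cdot)e \in \mathfrak{H}$; (2) for all $\lambda \in D$, $f \in \mathfrak{H}$, $e \in E$, $\langle f, k(\lambda,\cdot)e\rangle_{\mathfrak{H}} = \langle f(\lambda), e\rangle_E$. *)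

theory Defs
  imports "HOL-Analysis.Analysis" "HOL-Algebra.Module" "HOL-Algebra.Algebraic_Closure_Type"
begin

text \<open>
  A complex inner product space is a library real inner product space with a compatible
  complex scalar multiplication and a sesquilinear form, linear in the first argument, whose
  real part is the real inner product. Norm and topology are thus the library's ones, and
  positive definiteness of the form is inherited from the real inner product.
\<close>

class complex_inner = real_inner +
  fixes scaleC :: "complex \<Rightarrow> 'a \<Rightarrow> 'a"  (infixr \<open>*\<^sub>C\<close> 75)
    and cinner :: "'a \<Rightarrow> 'a \<Rightarrow> complex"
  assumes scaleC_add_right: "c *\<^sub>C (x + y) = c *\<^sub>C x + c *\<^sub>C y"
    and scaleC_add_left: "(c + d) *\<^sub>C x = c *\<^sub>C x + d *\<^sub>C x"
    and scaleC_scaleC: "c *\<^sub>C (d *\<^sub>C x) = (c * d) *\<^sub>C x"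
    and scaleR_scaleC: "scaleR r x = complex_of_real r *\<^sub>C x"
    and cinner_add_left: "cinner (x + y) z = cinner x z + cinner y z"
    and cinner_scaleC_left: "cinner (c *\<^sub>C x) y = c * cinner x y"
    and cinner_commute: "cinner y x = cnj (cinner x y)"
    and inner_eq_Re_cinner: "inner x y = Re (cinner x y)"

class complex_hilbert = complex_inner + complete_space

subclass (in complex_hilbert) banach ..

global_interpretation complex_vector: vector_space "scaleC :: complex \<Rightarrow> 'a \<Rightarrow> 'a::complex_inner"
  defines cspan = complex_vector.span
proof
  show "c *\<^sub>C (x + y) = c *\<^sub>C x + c *\<^sub>C y" for c and x y :: 'a
    by (rule scaleC_add_right)
  show "(c + d) *\<^sub>C x = c *\<^sub>C x + d *\<^sub>C x" for c d and x :: 'a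
    by (rule scaleC_add_left)
  show "c *\<^sub>C (d *\<^sub>C x) = (c * d) *\<^sub>C x" for c d and x :: 'a
    by (rule scaleC_scaleC)
  show "1 *\<^sub>C x = x" for x :: 'a
    using scaleR_scaleC[of 1 x] by simp
qed

definition infinite_dimensional :: "'a::complex_inner itself \<Rightarrow> bool" where
  "infinite_dimensional _ \<longleftrightarrow> \<not> (\<exists>B::'a set. finite B \<and> cspan B = UNIV)"

definition bounded_clinear :: "('a::complex_inner \<Rightarrow> 'a) \<Rightarrow> bool" where
  "bounded_clinear A \<longleftrightarrow> bounded_linear A \<and> (\<forall>c x. A (c *\<^sub>C x) = c *\<^sub>C A x)"

definition C0_semigroup :: "(real \<Rightarrow> 'a::complex_inner \<Rightarrow> 'a) \<Rightarrow> bool" where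
  "C0_semigroup T \<longleftrightarrow>
     (\<forall>t\<ge>0. bounded_clinear (T t)) \<and>
     T 0 = id \<and>
     (\<forall>s\<ge>0. \<forall>t\<ge>0. T (s + t) = T s \<circ> T t) \<and>
     (\<forall>x. continuous_on {0..} (\<lambda>t. T t x))"

definition pure_op :: "('a::complex_inner \<Rightarrow> 'a) \<Rightarrow> bool" where
  "pure_op A \<longleftrightarrow> (\<Inter>n::nat. range (A ^^ n)) = {0}"

definition concave_op :: "('a::complex_inner \<Rightarrow> 'a) \<Rightarrow> bool" where
  "concave_op A \<longleftrightarrow> (\<forall>x. (norm (A (A x)))\<^sup>2 + (norm x)\<^sup>2 \<le> 2 * (norm (A x))\<^sup>2)"

text \<open>
  Hilbert spaces whose existence is asserted have to be structures with an explicit carrier.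
  They extend the library's record of modules over a ring; as usual for modules, the
  fields \<open>mult\<close> and \<open>one\<close> of that record are irrelevant.
\<close>

record 'v inner_module = "(complex, 'v) module" +
  ip :: "'v \<Rightarrow> 'v \<Rightarrow> complex"

definition ip_norm :: "('v, 'b) inner_module_scheme \<Rightarrow> 'v \<Rightarrow> real" where
  "ip_norm V x = sqrt (Re (ip V x x))"

locale hilbert_space = Module.module "ring_of_type_algebra :: complex ring" V
  for V :: "('v, 'b) inner_module_scheme" (structure) +
  assumes ip_add_left:
      "\<lbrakk>x \<in> carrier V; y \<in> carrier V; z \<in> carrier V\<rbrakk> \<Longrightarrow> ip V (x \<oplus> y) z = ip V x z + ip V y z"
    and ip_smult_left:
      "\<lbrakk>x \<in> carrier V; y \<in> carrier V\<rbrakk> \<Longrightarrow> ip V (c \<odot> x) y = c * ip V x y"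
    and ip_commute:
      "\<lbrakk>x \<in> carrier V; y \<in> carrier V\<rbrakk> \<Longrightarrow> ip V y x = cnj (ip V x y)"
    and ip_pos:
      "\<lbrakk>x \<in> carrier V; x \<noteq> \<zero>\<rbrakk> \<Longrightarrow> 0 < Re (ip V x x)"
    and complete:
      "Metric_space.mcomplete (carrier V) (\<lambda>x y. ip_norm V (x \<ominus> y))"

definition bounded_operator_on :: "('v, 'b) inner_module_scheme \<Rightarrow> ('v \<Rightarrow> 'v) \<Rightarrow> bool" where
  "bounded_operator_on V A \<longleftrightarrow>
     A \<in> carrier V \<rightarrow> carrier V \<and>
     (\<forall>x\<in>carrier V. \<forall>y\<in>carrier V. A (x \<oplus>\<^bsub>V\<^esub> y) = A x \<oplus>\<^bsub>V\<^esub> A y) \<and>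
     (\<forall>c. \<forall>x\<in>carrier V. A (c \<odot>\<^bsub>V\<^esub> x) = c \<odot>\<^bsub>V\<^esub> A x) \<and>
     (\<exists>C. \<forall>x\<in>carrier V. ip_norm V (A x) \<le> C * ip_norm V x)"

definition unitary_onto :: "('v, 'b) inner_module_scheme \<Rightarrow> ('a::complex_inner \<Rightarrow> 'v) \<Rightarrow> bool" where
  "unitary_onto V U \<longleftrightarrow>
     bij_betw U UNIV (carrier V) \<and>
     (\<forall>x y. U (x + y) = U x \<oplus>\<^bsub>V\<^esub> U y) \<and>
     (\<forall>c x. U (c *\<^sub>C x) = c \<odot>\<^bsub>V\<^esub> U x) \<and>
     (\<forall>x y. ip V (U x) (U y) = cinner x y)"

text \<open>
  Functions on a set \<open>D\<close> are represented by extensional functions, so that two of them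
  are equal as soon as they agree on \<open>D\<close>. Holomorphy is complex differentiability in norm.
\<close>

definition holomorphic_into ::
    "complex set \<Rightarrow> ('e, 'b) inner_module_scheme \<Rightarrow> (complex \<Rightarrow> 'e) set" where
  "holomorphic_into D E = {f \<in> D \<rightarrow>\<^sub>E carrier E.
     \<forall>z\<in>D. \<exists>d\<in>carrier E.
       ((\<lambda>w. ip_norm E ((inverse (w - z) \<odot>\<^bsub>E\<^esub> (f w \<ominus>\<^bsub>E\<^esub> f z)) \<ominus>\<^bsub>E\<^esub> d)) \<longlongrightarrow> 0) (at z)}"

definition reproducing_kernel ::
    "complex set \<Rightarrow> ('e, 'b) inner_module_scheme \<Rightarrow> (complex \<Rightarrow> 'e, 'c) inner_module_scheme \<Rightarrow>
     (complex \<Rightarrow> complex \<Rightarrow> 'e \<Rightarrow> 'e) \<Rightarrow> bool" where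
  "reproducing_kernel D E F k \<longleftrightarrow>
     (\<forall>\<mu>\<in>D. \<forall>z\<in>D. bounded_operator_on E (k \<mu> z)) \<and>
     (\<forall>\<mu>\<in>D. \<forall>e\<in>carrier E. (\<lambda>z\<in>D. k \<mu> z e) \<in> carrier F) \<and>
     (\<forall>\<mu>\<in>D. \<forall>f\<in>carrier F. \<forall>e\<in>carrier E. ip F f (\<lambda>z\<in>D. k \<mu> z e) = ip E (f \<mu>) e)"

definition holomorphic_rkhs ::
    "complex set \<Rightarrow> ('e, 'b) inner_module_scheme \<Rightarrow> (complex \<Rightarrow> 'e, 'c) inner_module_scheme \<Rightarrow> bool" where
  "holomorphic_rkhs D E F \<longleftrightarrow>
     hilbert_space F \<and>
     carrier F \<subseteq> holomorphic_into D E \<and>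
     (\<forall>f\<in>carrier F. \<forall>g\<in>carrier F. f \<oplus>\<^bsub>F\<^esub> g = (\<lambda>z\<in>D. f z \<oplus>\<^bsub>E\<^esub> g z)) \<and>
     (\<forall>c. \<forall>f\<in>carrier F. c \<odot>\<^bsub>F\<^esub> f = (\<lambda>z\<in>D. c \<odot>\<^bsub>E\<^esub> f z)) \<and>
     (\<exists>k. reproducing_kernel D E F k)"

text \<open>
  If \<open>1 \<in> D\<close>, the value at 1 is subject to the convention \<open>x / 0 = 0\<close>. Boundedness of this operator
  on a space of holomorphic functions rules that case out, unless the space is trivial: the exponential
  has an essential singularity at 1.
\<close>

definition mult_exp ::
    "complex set \<Rightarrow> ('e, 'b) inner_module_scheme \<Rightarrow> real \<Rightarrow> (complex \<Rightarrow> 'e) \<Rightarrow> (complex \<Rightarrow> 'e)" where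
  "mult_exp D E t f = (\<lambda>z\<in>D. exp (complex_of_real t * ((z + 1) / (z - 1))) \<odot>\<^bsub>E\<^esub> f z)"

end

theory Submission
  imports Defs
begin

text \<open>
  A concave sequence that is bounded below is nondecreasing and grows at most linearly. Applied to
  \<open>\<parallel>T\<^sup>n x\<parallel>\<^sup>2\<close> this shows that each \<open>T\<^sub>t\<close> is expansive, \<open>\<parallel>x\<parallel> \<le> \<parallel>T\<^sub>t x\<parallel>\<close>, and that the resolvent
  \<open>R = (1 - A)\<^sup>-\<^sup>1 = \<integral>\<^sub>0\<^sup>\<infinity> exp (- s) T\<^sub>s ds\<close> of the generator \<open>A\<close> exists (\<open>concave_imp_expansive_semigroup\<close>).
  Differentiating the norm along orbits turns expansivity into accretivity of \<open>A\<close>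
  (\<open>resolvent_accretive\<close>), and hence the Cayley transform \<open>V = (A + 1) (A - 1)\<^sup>-\<^sup>1 = 1 - 2 R\<close> is expansive as
  well. It therefore has a contractive left inverse \<open>L\<close>.

  For \<open>\<bar>z\<bar> < 1\<close> the operator \<open>ev\<^sub>z = (1 - V L) (1 - z L)\<^sup>-\<^sup>1\<close> is holomorphic in \<open>z\<close> and satisfies
  \<open>ev\<^sub>z V = z ev\<^sub>z\<close>. Since \<open>V\<close> determines \<open>R\<close> and \<open>R\<close> determines the semigroup, it follows that
  \<open>ev\<^sub>z T\<^sub>t = exp (t (z + 1) / (z - 1)) ev\<^sub>z\<close> (\<open>eval_semigroup\<close>). So \<open>U x = (z \<mapsto> ev\<^sub>z x)\<close> carries the semigroup
  to the required multiplication operators. The values of \<open>U x\<close> may be taken in the given Hilbert space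
  itself, and the inner product of the function space is transported along \<open>U\<close>; the reproducing kernel
  is then \<open>ev\<^sub>z (ev\<^sub>\<mu>)\<^sup>*\<close>, with the adjoint supplied by the Riesz theorem. The radius is \<open>1\<close>.

  What remains is that \<open>U\<close> is injective, and this is where purity enters. If \<open>x\<close> belongs to the joint kernel
  of all \<open>ev\<^sub>z\<close>, then \<open>x\<close> can be divided by \<open>V - q\<close> inside that kernel, for every \<open>q\<close> in the disc
  (\<open>joint_kernel_division\<close>). In terms of \<open>A\<close> this says that \<open>1 + h A\<close> can be inverted there for all
  \<open>0 < h < 1\<close>, and the inverse is a contraction because \<open>A\<close> is accretive. Iterating it with \<open>h = t / n\<close> is
  the backward Euler scheme for the inverse semigroup, and as \<open>n\<close> tends to infinity it shows that \<open>R\<^sup>2 x\<close>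
  belongs to the range of every \<open>T\<^sub>t\<close> (\<open>joint_kernel_subset_range\<close>). By purity \<open>R\<^sup>2 x = 0\<close>, and \<open>R\<close> is
  injective.
\<close>

section \<open>Complex inner products and bounded operators\<close>

lemma cinner_scaleC_right: "cinner x (c *\<^sub>C y) = cnj c * cinner x (y :: 'a::complex_inner)"
  by (metis cinner_scaleC_left cinner_commute complex_cnj_mult)

lemma norm_scaleC: "norm (c *\<^sub>C x) = cmod c * norm (x :: 'a::complex_inner)"
proof -
  have "(norm (c *\<^sub>C x))\<^sup>2 = Re (c * cnj c * cinner x x)"
    by (simp add: power2_norm_eq_inner inner_eq_Re_cinner cinner_scaleC_left cinner_scaleC_right algebra_simps)
  also have "\<dots> = (cmod c * norm x)\<^sup>2"
    by (simp add: complex_norm_square[symmetric] power_mult_distrib power2_norm_eq_inner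
        inner_eq_Re_cinner flip: of_real_power)
  finally show ?thesis
    by (simp add: power2_eq_iff_nonneg)
qed

lemma bounded_bilinear_scaleC: "bounded_bilinear (scaleC :: complex \<Rightarrow> 'a \<Rightarrow> 'a::complex_inner)"
proof
  fix c d :: complex and x y :: 'a and r :: real
  show "(c + d) *\<^sub>C x = c *\<^sub>C x + d *\<^sub>C x" "c *\<^sub>C (x + y) = c *\<^sub>C x + c *\<^sub>C y"
    by (rule scaleC_add_left scaleC_add_right)+
  show "(r *\<^sub>R c) *\<^sub>C x = r *\<^sub>R (c *\<^sub>C x)" "c *\<^sub>C (r *\<^sub>R x) = r *\<^sub>R (c *\<^sub>C x)"
    by (simp_all add: scaleR_scaleC scaleC_scaleC scaleR_conv_of_real mult.commute)
  show "\<exists>K. \<forall>(c::complex) x::'a. norm (c *\<^sub>C x) \<le> norm c * norm x * K"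
    by (rule exI[of _ 1]) (simp add: norm_scaleC)
qed

lemma cinner_eqI_inner:
  fixes a b a' b' :: "'a::complex_inner"
  assumes "\<And>c. inner a (c *\<^sub>C b) = inner a' (c *\<^sub>C b')"
  shows "cinner a b = cinner a' b'"
  using assms[of 1] assms[of \<i>]
  by (simp add: inner_eq_Re_cinner cinner_scaleC_right complex_eq_iff)

lemma inner_left_eqI: "(\<And>w. inner a w = inner b w) \<Longrightarrow> a = (b :: 'a::real_inner)"
  by (metis inner_commute vector_eq_ldot)

lemma bounded_clinearI:
  fixes A :: "'a::complex_inner \<Rightarrow> 'a"
  assumes "\<And>x y. A (x + y) = A x + A y" "\<And>c x. A (c *\<^sub>C x) = c *\<^sub>C A x"
    and "\<And>x. norm (A x) \<le> K * norm x"
  shows "bounded_clinear A"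
  unfolding bounded_clinear_def
proof (intro conjI allI)
  show "bounded_linear A"
    by (rule bounded_linear_intro[where K = K])
       (simp_all add: assms scaleR_scaleC mult.commute[of _ K])
qed (rule assms)

lemma bounded_clinearD:
  assumes "bounded_clinear A"
  shows "bounded_linear A" "A (c *\<^sub>C x) = c *\<^sub>C A x" "A (x + y) = A x + A y" "A (x - y) = A x - A y"
    "A (r *\<^sub>R x) = r *\<^sub>R A x" "A 0 = 0"
  using assms unfolding bounded_clinear_def
  by (auto simp: bounded_linear.linear linear_add linear_diff linear_cmul linear_0)

lemma bounded_clinear_bound:
  assumes "bounded_clinear A"
  obtains K where "K > 0" "\<And>x. norm (A x) \<le> K * norm x"
  using bounded_linear.pos_bounded[OF bounded_clinearD(1)[OF assms]] by (metis mult.commute)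

lemma bounded_clinear_compose:
  assumes "bounded_clinear A" "bounded_clinear B"
  shows "bounded_clinear (\<lambda>x. A (B x))"
  using bounded_linear_compose[OF assms[THEN bounded_clinearD(1)]] assms
  by (simp add: bounded_clinear_def)

lemma bounded_clinear_id: "bounded_clinear (\<lambda>x. x)"
  by (simp add: bounded_clinear_def)

lemma bounded_clinear_diff:
  assumes "bounded_clinear A" "bounded_clinear B"
  shows "bounded_clinear (\<lambda>x. A x - B x)"
  using assms by (simp add: bounded_clinear_def bounded_linear_sub complex_vector.scale_right_diff_distrib)

lemma bounded_clinear_scaleC:
  assumes "bounded_clinear A"
  shows "bounded_clinear (\<lambda>x. c *\<^sub>C A x)"
  unfolding bounded_clinear_def
proof (intro conjI allI)
  show "bounded_linear (\<lambda>x. c *\<^sub>C A x)"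
    using bounded_linear_compose[OF bounded_bilinear.bounded_linear_right[OF bounded_bilinear_scaleC]
        bounded_clinearD(1)[OF assms]] .
  show "c *\<^sub>C A (d *\<^sub>C x) = d *\<^sub>C c *\<^sub>C A x" for d x
    by (simp add: bounded_clinearD[OF assms] scaleC_scaleC mult.commute)
qed

section \<open>Riesz representation, adjoints and left inverses\<close>

text \<open>
  The Dirichlet principle: the quadratic functional \<open>\<parallel>V y\<parallel>\<^sup>2 - 2 f y\<close> is bounded below, minimising
  sequences are Cauchy by the parallelogram identity, and the first variation vanishes at the
  minimum. With \<open>V\<close> the identity this is the Riesz representation theorem; with \<open>f w = \<langle>x, V w\<rangle>\<close>
  the minimiser is the preimage under \<open>V\<close> of the orthogonal projection of \<open>x\<close> to the range of \<open>V\<close>.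
\<close>

lemma dirichlet_principle:
  fixes V :: "'a::{real_inner,complete_space} \<Rightarrow> 'b::real_inner" and f :: "'a \<Rightarrow> real"
  assumes V: "bounded_linear V" and expansive: "\<And>y. norm y \<le> norm (V y)" and f: "bounded_linear f"
  shows "\<exists>y. \<forall>w. inner (V y) (V w) = f w"
proof -
  interpret V: bounded_linear V by fact
  interpret f: bounded_linear f by fact
  define J where "J y = (norm (V y))\<^sup>2 - 2 * f y" for y
  obtain K where K: "K > 0" "\<And>y. \<bar>f y\<bar> \<le> norm y * K"
    using f.pos_bounded by auto
  have lower: "- K\<^sup>2 \<le> J y" for y
  proof -
    have "f y \<le> norm (V y) * K"
      using K(2)[of y] mult_right_mono[OF expansive[of y], of K] K(1) by linarith
    moreover have "0 \<le> (norm (V y) - K)\<^sup>2" by simp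
    ultimately show ?thesis by (simp add: J_def power2_eq_square algebra_simps)
  qed
  define m where "m = Inf (range J)"
  have bdd: "bdd_below (range J)"
    using lower by (auto intro!: bdd_belowI2)
  have m_le: "m \<le> J y" for y
    unfolding m_def by (rule cInf_lower) (auto simp: bdd)
  have "\<exists>y. J y < m + 1 / Suc n" for n
  proof -
    have "Inf (range J) < m + 1 / Suc n" by (simp add: m_def)
    then show ?thesis using cInf_lessD[of "range J"] by auto
  qed
  then obtain y where y: "\<And>n. J (y n) < m + 1 / Suc n" by metis
  \<comment> \<open>The midpoint of two near minimisers has \<open>J \<ge> m\<close>, so the parallelogram identity bounds their distance.\<close>
  have close: "(norm (y n - y k))\<^sup>2 \<le> 2 * (1 / Suc n + 1 / Suc k)" for n k
  proof -
    have "(norm (V (y n - y k)))\<^sup>2 = 2 * J (y n) + 2 * J (y k) - 4 * J ((1/2) *\<^sub>R (y n + y k))"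
      by (simp add: J_def V.diff V.add V.scaleR f.add f.scaleR power2_norm_eq_inner
          inner_add inner_diff inner_commute algebra_simps)
    moreover have "(norm (y n - y k))\<^sup>2 \<le> (norm (V (y n - y k)))\<^sup>2"
      by (intro power_mono expansive) auto
    ultimately show ?thesis
      using y[of n] y[of k] m_le[of "(1/2) *\<^sub>R (y n + y k)"] by simp
  qed
  have "Cauchy y"
    unfolding Cauchy_altdef
  proof (intro allI impI)
    fix e :: real assume e: "e > 0"
    obtain N where N: "inverse (real (Suc N)) < e\<^sup>2 / 4"
      using reals_Archimedean[of "e\<^sup>2 / 4"] e by auto
    have "dist (y n) (y k) < e" if "n \<ge> N" "k > n" for n k
    proof -
      have "1 / real (Suc n) \<le> inverse (Suc N)" "1 / real (Suc k) \<le> inverse (Suc N)"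
        using that by (auto simp: field_simps)
      then have "2 * (1 / real (Suc n) + 1 / real (Suc k)) < e\<^sup>2" using N by argo
      then have "(norm (y n - y k))\<^sup>2 < e\<^sup>2" using close[of n k] by (rule le_less_trans[rotated])
      then show ?thesis using e by (simp add: dist_norm power2_less_imp_less)
    qed
    then show "\<exists>M. \<forall>m\<ge>M. \<forall>n>m. dist (y m) (y n) < e" by blast
  qed
  then obtain l where l: "y \<longlonglongrightarrow> l" using Cauchy_convergent[of y] unfolding convergent_def by blast
  have "(\<lambda>n. J (y n)) \<longlonglongrightarrow> J l"
    unfolding J_def by (intro tendsto_intros V.tendsto f.tendsto l)
  moreover have "(\<lambda>n. m + 1 / Suc n) \<longlonglongrightarrow> m + 0"
    by (intro tendsto_add tendsto_const LIMSEQ_Suc[OF lim_1_over_n])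
  ultimately have "J l \<le> m + 0"
    by (rule LIMSEQ_le) (meson y less_imp_le)
  then have J_l: "J l \<le> m" by simp
  have "inner (V l) (V w) = f w" for w
  proof -
    define b where "b = inner (V l) (V w) - f w"
    define a where "a = (norm (V w))\<^sup>2 + 1"
    have a: "a > 0" by (simp add: a_def add_nonneg_pos)
    have "0 \<le> J (l + t *\<^sub>R w) - J l" for t
      using m_le[of "l + t *\<^sub>R w"] J_l by linarith
    moreover have "J (l + t *\<^sub>R w) - J l = t\<^sup>2 * (norm (V w))\<^sup>2 + 2 * t * b" for t
      by (simp add: J_def b_def V.add V.scaleR f.add f.scaleR power2_norm_eq_inner
          inner_add inner_commute algebra_simps power2_eq_square[of t])
    ultimately have nonneg: "0 \<le> t\<^sup>2 * (norm (V w))\<^sup>2 + 2 * t * b" for t by metis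
    have "t\<^sup>2 * (norm (V w))\<^sup>2 \<le> t\<^sup>2 * a" for t :: real
      by (intro mult_left_mono) (auto simp: a_def)
    then have "0 \<le> (- b / a)\<^sup>2 * a + 2 * (- b / a) * b"
      using nonneg[of "- b / a"] by (meson add_right_mono order_trans)
    also have "\<dots> = - (b\<^sup>2 / a)" using a by (simp add: field_simps power2_eq_square)
    finally have "b = 0" using a by (simp add: zero_le_divide_iff divide_le_0_iff)
    then show ?thesis by (simp add: b_def)
  qed
  then show ?thesis by blast
qed

lemma adjoint_exists:
  fixes A :: "'a::complex_hilbert \<Rightarrow> 'a"
  assumes A: "bounded_clinear A"
  shows "\<exists>B. bounded_clinear B \<and> (\<forall>x y. cinner (A x) y = cinner x (B y))"
proof -
  obtain K where K: "K > 0" "\<And>x. norm (A x) \<le> K * norm x"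
    using bounded_clinear_bound[OF A] by blast
  have "\<exists>b. \<forall>x. inner b x = inner y (A x)" for y
    using dirichlet_principle[of "\<lambda>x::'a. x" "\<lambda>x. inner y (A x)"]
      bounded_linear_compose[OF bounded_linear_inner_right bounded_clinearD(1)[OF A]] by simp
  then obtain B where B: "\<And>x y. inner (B y) x = inner y (A x)" by metis
  have cB: "cinner (B y) x = cinner y (A x)" for x y
    by (rule cinner_eqI_inner) (simp add: B flip: bounded_clinearD(2)[OF A])
  have "bounded_clinear B"
  proof (rule bounded_clinearI[where K = K])
    show "B (x + y) = B x + B y" for x y
      by (rule inner_left_eqI) (simp add: B inner_add_left)
    show "B (c *\<^sub>C x) = c *\<^sub>C B x" for c x
      by (rule inner_left_eqI) (simp add: inner_eq_Re_cinner cB cinner_scaleC_left)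
    show "norm (B x) \<le> K * norm x" for x
    proof -
      have "norm (B x) * norm (B x) = inner x (A (B x))"
        using B[of x "B x"] by (simp add: power2_norm_eq_inner flip: power2_eq_square)
      also have "\<dots> \<le> norm x * (K * norm (B x))"
        using norm_cauchy_schwarz[of x "A (B x)"] mult_left_mono[OF K(2)[of "B x"], of "norm x"] by simp
      finally show ?thesis
        using K(1) by (cases "norm (B x) = 0") (auto simp: mult_ac)
    qed
  qed
  moreover have "cinner (A x) y = cinner x (B y)" for x y
    by (metis cB cinner_commute)
  ultimately show ?thesis by blast
qed

text \<open>
  The left inverse is \<open>(V\<^sup>* V)\<^sup>-\<^sup>1 V\<^sup>*\<close>, the adjoint of the Cauchy dual of \<open>V\<close>.
  It is a contraction because \<open>V L\<close> is the orthogonal projection to the range of \<open>V\<close>.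
\<close>

lemma contractive_left_inverse_exists:
  fixes V :: "'a::complex_hilbert \<Rightarrow> 'a"
  assumes V: "bounded_clinear V" and expansive: "\<And>y. norm y \<le> norm (V y)"
  shows "\<exists>L. bounded_clinear L \<and> (\<forall>x. norm (L x) \<le> norm x) \<and> (\<forall>x. L (V x) = x)"
proof -
  note lin = bounded_clinearD[OF V]
  have "\<exists>y. \<forall>w. inner (V y) (V w) = inner x (V w)" for x
    using dirichlet_principle[OF lin(1) expansive]
      bounded_linear_compose[OF bounded_linear_inner_right lin(1)] by blast
  then obtain L where L: "\<And>x w. inner (V (L x)) (V w) = inner x (V w)" by metis
  have cL: "cinner (V (L x)) (V w) = cinner x (V w)" for x w
    by (rule cinner_eqI_inner) (simp add: L flip: lin(2))
  have unique: "a = b" if "\<And>w. inner (V a) (V w) = inner (V b) (V w)" for a b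
  proof -
    have "inner (V (a - b)) (V (a - b)) = 0"
      using that[of "a - b"] by (simp add: lin inner_diff)
    then show ?thesis using expansive[of "a - b"] by simp
  qed
  have contr: "norm (L x) \<le> norm x" for x
  proof -
    have "norm (V (L x)) * norm (V (L x)) = inner x (V (L x))"
      using L[of x "L x"] by (simp add: power2_norm_eq_inner flip: power2_eq_square)
    also have "\<dots> \<le> norm x * norm (V (L x))" by (rule norm_cauchy_schwarz)
    finally have "norm (V (L x)) \<le> norm x" by (cases "norm (V (L x)) = 0") auto
    then show ?thesis using expansive[of "L x"] by linarith
  qed
  have "bounded_clinear L"
  proof (rule bounded_clinearI[where K = 1])
    show "L (x + y) = L x + L y" for x y
      by (rule unique) (simp add: lin L inner_add_left)
    show "L (c *\<^sub>C x) = c *\<^sub>C L x" for c x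
    proof (rule unique)
      fix w
      have "cinner (V (L (c *\<^sub>C x))) (V w) = cinner (V (c *\<^sub>C L x)) (V w)"
        by (simp add: lin cL cinner_scaleC_left)
      then show "inner (V (L (c *\<^sub>C x))) (V w) = inner (V (c *\<^sub>C L x)) (V w)"
        by (simp add: inner_eq_Re_cinner)
    qed
  qed (simp add: contr)
  moreover have "L (V x) = x" for x by (rule unique) (simp add: L)
  ultimately show ?thesis using contr by blast
qed

section \<open>Neumann series\<close>

definition neumann :: "('a::real_normed_vector \<Rightarrow> 'a) \<Rightarrow> 'a \<Rightarrow> 'a" where
  "neumann B x = (\<Sum>n. (B ^^ n) x)"

locale geometric_powers =
  fixes B :: "'a::complex_hilbert \<Rightarrow> 'a" and M q :: real
  assumes clinear: "bounded_clinear B" and q: "0 \<le> q" "q < 1"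
    and power_bound: "\<And>n x. norm ((B ^^ n) x) \<le> M * q ^ n * norm x"
begin

lemma summable_powers: "summable (\<lambda>n. (B ^^ n) x)"
proof (rule summable_comparison_test'[where N = 0])
  show "summable (\<lambda>n. M * q ^ n * norm x)"
    using q by (intro summable_mult summable_mult2 summable_geometric) auto
qed (rule power_bound)

lemma apply_neumann: "B (neumann B x) = neumann B x - x"
proof -
  have "B (neumann B x) = (\<Sum>n. (B ^^ Suc n) x)"
    unfolding neumann_def
    by (subst bounded_linear.suminf[OF bounded_clinearD(1)[OF clinear] summable_powers]) simp
  also have "\<dots> = neumann B x - x"
    using suminf_split_head[OF summable_powers[of x]] by (simp add: neumann_def)
  finally show ?thesis .
qed

lemma fixed_point_zero:
  assumes "B y = y" shows "y = 0"
proof -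
  have "(B ^^ n) y = y" for n by (induction n) (simp_all add: assms)
  then have "norm y \<le> M * q ^ n * norm y" for n using power_bound[of n y] by simp
  moreover have "(\<lambda>n. M * q ^ n * norm y) \<longlonglongrightarrow> M * 0 * norm y"
    using q by (intro tendsto_mult tendsto_const LIMSEQ_power_zero) auto
  ultimately have "norm y \<le> M * 0 * norm y" by (intro LIMSEQ_le_const) auto
  then show ?thesis by simp
qed

lemma neumann_unique:
  assumes "y - B y = x" shows "neumann B x = y"
proof -
  have "B (neumann B x - y) = neumann B x - y"
    using apply_neumann[of x] by (simp add: bounded_clinearD[OF clinear] flip: assms)
  then show ?thesis using fixed_point_zero[of "neumann B x - y"] by simp
qed

lemma norm_neumann: "norm (neumann B x) \<le> M / (1 - q) * norm x"
proof -
  have sums: "(\<lambda>n. M * q ^ n * norm x) sums (M * (1 / (1 - q)) * norm x)"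
    using q by (intro sums_mult sums_mult2 geometric_sums) auto
  have "norm (neumann B x) \<le> (\<Sum>n. M * q ^ n * norm x)"
    unfolding neumann_def by (rule norm_suminf_le[OF power_bound sums_summable[OF sums]])
  also have "\<dots> = M / (1 - q) * norm x"
    using sums_unique[OF sums] by simp
  finally show ?thesis .
qed

lemma bounded_clinear_neumann: "bounded_clinear (neumann B)"
proof (rule bounded_clinearI[OF _ _ norm_neumann])
  note lin = bounded_clinearD[OF clinear]
  show "neumann B (x + y) = neumann B x + neumann B y" for x y
    by (rule neumann_unique) (simp add: lin apply_neumann)
  show "neumann B (c *\<^sub>C x) = c *\<^sub>C neumann B x" for c x
    by (rule neumann_unique) (simp add: lin apply_neumann complex_vector.scale_right_diff_distrib)
qed

end

section \<open>Expansive semigroups and their resolvent\<close>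

lemma concave_power_bound:
  assumes "concave_op A"
  shows "(norm ((A ^^ n) x))\<^sup>2 \<le> (norm x)\<^sup>2 + n * ((norm (A x))\<^sup>2 - (norm x)\<^sup>2)"
proof -
  have concave: "(norm ((A ^^ Suc (Suc k)) x))\<^sup>2 - (norm ((A ^^ Suc k) x))\<^sup>2
      \<le> (norm ((A ^^ Suc k) x))\<^sup>2 - (norm ((A ^^ k) x))\<^sup>2" for k
    using assms[unfolded concave_op_def, rule_format, of "(A ^^ k) x"] by simp
  have step: "(norm ((A ^^ Suc k) x))\<^sup>2 - (norm ((A ^^ k) x))\<^sup>2 \<le> (norm (A x))\<^sup>2 - (norm x)\<^sup>2" for k
  proof (induction k)
    case (Suc k)
    then show ?case using concave[of k] by linarith
  qed simp
  show ?thesis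
  proof (induction n)
    case (Suc n)
    then show ?case using step[of n] by (simp add: algebra_simps)
  qed simp
qed

text \<open>A concave sequence that is bounded below cannot decrease.\<close>

lemma concave_expansive:
  assumes "concave_op A"
  shows "norm x \<le> norm (A x)"
proof (rule ccontr)
  assume "\<not> norm x \<le> norm (A x)"
  then have less: "(norm x)\<^sup>2 - (norm (A x))\<^sup>2 > 0"
    by (simp add: power_strict_mono)
  obtain n :: nat where "(norm x)\<^sup>2 < n * ((norm x)\<^sup>2 - (norm (A x))\<^sup>2)"
    using reals_Archimedean3[OF less] by blast
  moreover have "(norm ((A ^^ n) x))\<^sup>2 \<le> (norm x)\<^sup>2 - n * ((norm x)\<^sup>2 - (norm (A x))\<^sup>2)"
    using concave_power_bound[OF assms, of n x] by (simp add: algebra_simps)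
  ultimately have "(norm ((A ^^ n) x))\<^sup>2 < 0" by linarith
  then show False using zero_le_power2 not_le by blast
qed

text \<open>
  A growth rate below \<open>1\<close> puts the point \<open>1\<close> into the resolvent set of the generator. Concave semigroups
  grow only like the square root of the time; \<open>1 / 2\<close> is a convenient rate.
\<close>

locale expansive_semigroup =
  fixes T :: "real \<Rightarrow> 'a::complex_hilbert \<Rightarrow> 'a" and M :: real
  assumes C0: "C0_semigroup T"
    and expansive: "0 \<le> t \<Longrightarrow> norm x \<le> norm (T t x)"
    and growth: "norm ((T 1 ^^ n) x) \<le> M * exp (n / 2) * norm x"

lemma concave_imp_expansive_semigroup:
  fixes T :: "real \<Rightarrow> 'a::complex_hilbert \<Rightarrow> 'a"
  assumes C0: "C0_semigroup T" and concave: "\<And>t. 0 < t \<Longrightarrow> concave_op (T t)"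
  shows "\<exists>M. expansive_semigroup T M"
proof -
  have "bounded_clinear (T 1)" using C0 by (simp add: C0_semigroup_def)
  then obtain K where K: "K > 0" "\<And>x. norm (T 1 x) \<le> K * norm x"
    using bounded_clinear_bound by blast
  have "expansive_semigroup T (1 + K)"
  proof
    show "norm x \<le> norm (T t x)" if "0 \<le> t" for t x
      using C0 concave_expansive[OF concave, of t] that
      by (cases "t = 0") (auto simp: C0_semigroup_def)
    show "norm ((T 1 ^^ n) x) \<le> (1 + K) * exp (n / 2) * norm x" for n x
    proof (rule power2_le_imp_le)
      have exp_ge: "1 + real n \<le> exp n" by (rule exp_ge_add_one_self)
      have "real n * (norm (T 1 x))\<^sup>2 \<le> exp n * (K * norm x)\<^sup>2"
        using exp_ge by (intro mult_mono power_mono K(2)) (linarith | simp)+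
      moreover have "(norm x)\<^sup>2 \<le> exp n * (norm x)\<^sup>2"
        using mult_right_mono[of 1 "exp n" "(norm x)\<^sup>2"] exp_ge by simp
      moreover have "0 \<le> 2 * K * exp n * (norm x)\<^sup>2" "0 \<le> n * (norm x)\<^sup>2"
        using K by simp_all
      moreover have "(norm ((T 1 ^^ n) x))\<^sup>2 \<le> (norm x)\<^sup>2 + n * (norm (T 1 x))\<^sup>2 - n * (norm x)\<^sup>2"
        using concave_power_bound[OF concave, of 1 n x] by (simp add: algebra_simps)
      ultimately have "(norm ((T 1 ^^ n) x))\<^sup>2
          \<le> exp n * (norm x)\<^sup>2 + exp n * (K * norm x)\<^sup>2 + 2 * K * exp n * (norm x)\<^sup>2"
        by linarith
      also have "\<dots> = ((1 + K) * exp (n / 2) * norm x)\<^sup>2"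
      proof -
        have "exp (real n) = (exp (n / 2))\<^sup>2" by (simp flip: exp_double)
        then show ?thesis by (simp add: power2_eq_square algebra_simps)
      qed
      finally show "(norm ((T 1 ^^ n) x))\<^sup>2 \<le> ((1 + K) * exp (n / 2) * norm x)\<^sup>2" .
    qed (use K in simp)
  qed (rule C0)
  then show ?thesis by blast
qed

context expansive_semigroup
begin

lemma T_clinear: "0 \<le> t \<Longrightarrow> bounded_clinear (T t)"
  using C0 by (simp add: C0_semigroup_def)

lemmas T_simps = T_clinear[THEN bounded_clinearD(2)] T_clinear[THEN bounded_clinearD(3)]
  T_clinear[THEN bounded_clinearD(4)] T_clinear[THEN bounded_clinearD(5)]

lemma T_0: "T 0 x = x"
  using C0 by (simp add: C0_semigroup_def)

lemma T_add: "\<lbrakk>0 \<le> s; 0 \<le> t\<rbrakk> \<Longrightarrow> T (s + t) x = T s (T t x)"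
  using C0 by (simp add: C0_semigroup_def)

lemma T_commute: "\<lbrakk>0 \<le> s; 0 \<le> t\<rbrakk> \<Longrightarrow> T s (T t x) = T t (T s x)"
  by (metis T_add add.commute)

lemma T_power: "0 \<le> t \<Longrightarrow> (T t ^^ n) x = T (n * t) x"
  by (induction n) (simp_all add: T_0 T_add distrib_right)

lemma continuous_T: "0 \<le> a \<Longrightarrow> continuous_on {a..b} (\<lambda>t. T t x)"
  using C0 unfolding C0_semigroup_def
  by (meson atLeastatMost_subset_iff continuous_on_subset Icc_subset_Ici_iff)

lemma norm_T_mono:
  assumes "0 \<le> s" "s \<le> t"
  shows "norm (T s x) \<le> norm (T t x)"
  using expansive[of "t - s" "T s x"] T_add[of "t - s" s x] assms by simp

definition truncated_resolvent :: "real \<Rightarrow> 'a \<Rightarrow> 'a" where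
  "truncated_resolvent t x = integral {0..t} (\<lambda>s. exp (- s) *\<^sub>R T s x)"

lemma integrand_continuous: "0 \<le> a \<Longrightarrow> continuous_on {a..b} (\<lambda>s. exp (- s) *\<^sub>R T s x)"
  by (intro continuous_intros continuous_T)

lemmas integrand_integrable = integrable_continuous_real[OF integrand_continuous]

lemma truncated_resolvent_shift:
  assumes "0 \<le> s" "0 \<le> t"
  shows "truncated_resolvent (s + t) x
    = truncated_resolvent s x + exp (- s) *\<^sub>R T s (truncated_resolvent t x)"
proof -
  let ?f = "\<lambda>r. exp (- r) *\<^sub>R T r x"
  have lin: "bounded_linear (\<lambda>y. exp (- s) *\<^sub>R T s y)"
    using bounded_linear_const_scaleR[OF T_clinear[OF assms(1), THEN bounded_clinearD(1)]] .
  have "integral {s..s + t} ?f = integral {0..t} (?f \<circ> (+) s)"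
    using integral_shift_Icc_real[of 0 t ?f s] by (simp add: add.commute)
  also have "\<dots> = integral {0..t} ((\<lambda>y. exp (- s) *\<^sub>R T s y) \<circ> ?f)"
    by (rule integral_cong)
       (use assms in \<open>simp add: T_add T_simps exp_diff exp_minus exp_add divide_inverse\<close>)
  also have "\<dots> = exp (- s) *\<^sub>R T s (truncated_resolvent t x)"
    unfolding truncated_resolvent_def
    by (rule integral_linear[OF integrand_integrable lin]) simp
  finally show ?thesis
    unfolding truncated_resolvent_def
    using Henstock_Kurzweil_Integration.integral_combine[where a = 0 and c = s and b = "s + t" and f = ?f] assms integrand_integrable by simp
qed

lemma truncated_resolvent_commute:
  assumes "0 \<le> t"
  shows "truncated_resolvent s (T t x) = T t (truncated_resolvent s x)"
proof -
  have "truncated_resolvent s (T t x) = integral {0..s} (T t \<circ> (\<lambda>r. exp (- r) *\<^sub>R T r x))"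
    unfolding truncated_resolvent_def
    by (rule integral_cong) (use assms in \<open>simp add: T_simps T_commute\<close>)
  also have "\<dots> = T t (truncated_resolvent s x)"
    unfolding truncated_resolvent_def
    by (rule integral_linear[OF integrand_integrable T_clinear[OF assms, THEN bounded_clinearD(1)]]) simp
  finally show ?thesis .
qed

lemma truncated_resolvent_clinear: "bounded_clinear (truncated_resolvent 1)"
proof -
  obtain K where K: "K > 0" "\<And>x. norm (T 1 x) \<le> K * norm x"
    using bounded_clinear_bound[OF T_clinear[of 1]] by auto
  show ?thesis
  proof (rule bounded_clinearI[where K = K])
    fix x y :: 'a and c :: complex
    have "truncated_resolvent 1 (x + y)
        = integral {0..1} (\<lambda>s. exp (- s) *\<^sub>R T s x + exp (- s) *\<^sub>R T s y)"
      unfolding truncated_resolvent_def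
      by (rule integral_cong) (simp add: T_simps scaleR_add_right)
    then show "truncated_resolvent 1 (x + y) = truncated_resolvent 1 x + truncated_resolvent 1 y"
      unfolding truncated_resolvent_def by (simp add: integral_add integrand_integrable)
    have "truncated_resolvent 1 (c *\<^sub>C x) = integral {0..1} (scaleC c \<circ> (\<lambda>s. exp (- s) *\<^sub>R T s x))"
      unfolding truncated_resolvent_def
      by (rule integral_cong) (simp add: T_simps scaleR_scaleC scaleC_scaleC mult.commute)
    also have "\<dots> = c *\<^sub>C truncated_resolvent 1 x"
      unfolding truncated_resolvent_def
      by (rule integral_linear[OF integrand_integrable
            bounded_bilinear.bounded_linear_right[OF bounded_bilinear_scaleC]]) simp
    finally show "truncated_resolvent 1 (c *\<^sub>C x) = c *\<^sub>C truncated_resolvent 1 x" .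
    have "norm (exp (- s) *\<^sub>R T s x) \<le> K * norm x" if "s \<in> {0..1}" for s
    proof -
      have "norm (exp (- s) *\<^sub>R T s x) \<le> norm (T s x)"
        using that by (simp add: mult_left_le_one_le)
      also have "\<dots> \<le> norm (T 1 x)" using that by (intro norm_T_mono) auto
      also have "\<dots> \<le> K * norm x" by (rule K)
      finally show ?thesis .
    qed
    then have "norm (truncated_resolvent 1 x) \<le> K * norm x * (1 - 0)"
      unfolding truncated_resolvent_def by (intro integral_bound integrand_continuous) auto
    then show "norm (truncated_resolvent 1 x) \<le> K * norm x" by simp
  qed
qed

end

sublocale expansive_semigroup \<subseteq> step: geometric_powers "\<lambda>x. exp (-1) *\<^sub>R T 1 x" M "exp (- 1 / 2)"
proof
  show "bounded_clinear (\<lambda>x. exp (- 1) *\<^sub>R T 1 x)"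
    using bounded_clinear_scaleC[OF T_clinear[of 1], of "complex_of_real (exp (- 1))"]
    by (simp add: scaleR_scaleC)
  have power: "((\<lambda>x. exp (- 1) *\<^sub>R T 1 x) ^^ n) x = exp (- real n) *\<^sub>R (T 1 ^^ n) x" for n x
    by (induction n) (simp_all add: T_simps exp_diff exp_minus field_simps)
  show "norm (((\<lambda>x. exp (- 1) *\<^sub>R T 1 x) ^^ n) x) \<le> M * exp (- 1 / 2) ^ n * norm x" for n x
  proof -
    have "norm (((\<lambda>x. exp (- 1) *\<^sub>R T 1 x) ^^ n) x) = exp (- real n) * norm ((T 1 ^^ n) x)"
      by (simp add: power)
    also have "\<dots> \<le> exp (- real n) * (M * exp (real n / 2) * norm x)"
      by (intro mult_left_mono growth) simp
    also have "\<dots> = M * (exp (- real n) * exp (real n / 2)) * norm x"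
      by simp
    also have "exp (- real n) * exp (real n / 2) = exp (- 1 / 2) ^ n"
      by (simp flip: exp_add exp_of_nat_mult)
    finally show ?thesis .
  qed
qed simp_all

context expansive_semigroup
begin

text \<open>
  The resolvent of the generator at \<open>1\<close>, i.e. \<open>\<integral>\<^sub>0\<^sup>\<infinity> exp (- s) T\<^sub>s x ds\<close>: the geometric series adds up
  the contributions of the unit intervals, which avoids an improper integral.
\<close>

definition resolvent :: "'a \<Rightarrow> 'a" where
  "resolvent x = neumann (\<lambda>x. exp (-1) *\<^sub>R T 1 x) (truncated_resolvent 1 x)"

lemma resolvent_clinear: "bounded_clinear resolvent"
  unfolding resolvent_def
  by (rule bounded_clinear_compose[OF step.bounded_clinear_neumann truncated_resolvent_clinear])

lemmas resolvent_simps = bounded_clinearD[OF resolvent_clinear]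

lemma resolvent_commute:
  assumes "0 \<le> t"
  shows "resolvent (T t x) = T t (resolvent x)"
  unfolding resolvent_def truncated_resolvent_commute[OF assms]
proof (rule step.neumann_unique)
  let ?y = "neumann (\<lambda>x. exp (- 1) *\<^sub>R T 1 x) (truncated_resolvent 1 x)"
  have "T t ?y - exp (- 1) *\<^sub>R T 1 (T t ?y) = T t (?y - exp (- 1) *\<^sub>R T 1 ?y)"
    using assms by (simp add: T_simps T_commute)
  then show "T t ?y - exp (- 1) *\<^sub>R T 1 (T t ?y) = T t (truncated_resolvent 1 x)"
    using step.apply_neumann[of "truncated_resolvent 1 x"] by simp
qed

lemma resolvent_truncation:
  assumes "0 \<le> t"
  shows "resolvent x - exp (- t) *\<^sub>R T t (resolvent x) = truncated_resolvent t x"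
proof -
  let ?S = "\<lambda>x. exp (- 1) *\<^sub>R T 1 x"
  let ?d = "resolvent x - exp (- t) *\<^sub>R T t (resolvent x) - truncated_resolvent t x"
  have S_R: "?S (resolvent x) = resolvent x - truncated_resolvent 1 x"
    unfolding resolvent_def by (rule step.apply_neumann)
  have "?S (T t (resolvent x)) = T t (?S (resolvent x))"
    using assms by (simp add: T_simps T_commute)
  also have "\<dots> = T t (resolvent x) - T t (truncated_resolvent 1 x)"
    unfolding S_R using assms by (simp add: T_simps)
  finally have S_TR: "?S (T t (resolvent x)) = T t (resolvent x) - T t (truncated_resolvent 1 x)" .
  \<comment> \<open>Truncating at \<open>1 + t\<close> in two ways.\<close>
  have "truncated_resolvent 1 x + ?S (truncated_resolvent t x)
      = truncated_resolvent t x + exp (- t) *\<^sub>R T t (truncated_resolvent 1 x)"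
    using truncated_resolvent_shift[of 1 t x] truncated_resolvent_shift[of t 1 x] assms
    by (simp add: add.commute)
  then have S_I: "?S (truncated_resolvent t x)
      = truncated_resolvent t x + exp (- t) *\<^sub>R T t (truncated_resolvent 1 x) - truncated_resolvent 1 x"
    by (simp add: algebra_simps)
  have "?S ?d = ?S (resolvent x) - exp (- t) *\<^sub>R ?S (T t (resolvent x)) - ?S (truncated_resolvent t x)"
    by (simp add: T_simps scaleR_diff_right mult.commute)
  also have "\<dots> = ?d"
    unfolding S_R S_TR S_I by (simp add: scaleR_diff_right)
  finally have "?d = 0" by (rule step.fixed_point_zero)
  then show ?thesis by simp
qed

text \<open>The range of the resolvent is the domain of the generator, which maps \<open>resolvent x\<close> to \<open>resolvent x - x\<close>.\<close>

lemma orbit_derivative: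
  assumes t: "t \<in> {0..b}"
  shows "((\<lambda>s. T s (resolvent x)) has_vector_derivative T t (resolvent x - x)) (at t within {0..b})"
proof (rule has_vector_derivative_transform[OF t])
  show "T s (resolvent x) = exp s *\<^sub>R (resolvent x - truncated_resolvent s x)" if "s \<in> {0..b}" for s
  proof -
    have "resolvent x - truncated_resolvent s x = exp (- s) *\<^sub>R T s (resolvent x)"
      using resolvent_truncation[of s x] that by (simp add: algebra_simps)
    then show ?thesis by (simp flip: exp_add)
  qed
  have "((\<lambda>s. truncated_resolvent s x) has_vector_derivative exp (- t) *\<^sub>R T t x) (at t within {0..b})"
    unfolding truncated_resolvent_def
    by (rule integral_has_vector_derivative[OF integrand_continuous t]) simp
  then have "((\<lambda>s. exp s *\<^sub>R (resolvent x - truncated_resolvent s x)) has_vector_derivative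
      exp t *\<^sub>R (0 - exp (- t) *\<^sub>R T t x) + exp t *\<^sub>R (resolvent x - truncated_resolvent t x))
      (at t within {0..b})"
    by (intro has_vector_derivative_scaleR has_vector_derivative_diff has_vector_derivative_const
        DERIV_subset[OF DERIV_exp]) auto
  moreover have "exp t *\<^sub>R (0 - exp (- t) *\<^sub>R T t x) + exp t *\<^sub>R (resolvent x - truncated_resolvent t x)
      = T t (resolvent x - x)"
    using resolvent_truncation[of t x, symmetric] t
    by (simp add: T_simps flip: exp_add)
  ultimately show "((\<lambda>s. exp s *\<^sub>R (resolvent x - truncated_resolvent s x)) has_vector_derivative
      T t (resolvent x - x)) (at t within {0..b})" by simp
qed

lemma resolvent_injective:
  assumes "resolvent x = 0"
  shows "x = 0"
proof -
  have "((\<lambda>s. T s (resolvent x)) has_vector_derivative resolvent x - x) (at 0 within {0..1})"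
    using orbit_derivative[of 0 1 x] by (simp add: T_0)
  moreover have "((\<lambda>s. T s (resolvent x)) has_vector_derivative 0) (at 0 within {0..1})"
    by (rule has_vector_derivative_transform[where f = "\<lambda>s. 0"])
       (auto simp: assms T_clinear[THEN bounded_clinearD(6)])
  ultimately have "resolvent x - x = 0"
    by (intro vector_derivative_unique_within[where x = 0 and S = "{0..1}"])
       (auto simp: at_within_Icc_at_right)
  then show ?thesis by (simp add: assms)
qed

text \<open>
  The norm along the orbit of \<open>resolvent x\<close> is minimal at time \<open>0\<close>, so the derivative of its square
  there is nonnegative.
\<close>

lemma resolvent_accretive: "0 \<le> inner (resolvent x) (resolvent x - x)"
proof (rule ccontr)
  define y where "y = resolvent x"
  assume "\<not> 0 \<le> inner (resolvent x) (resolvent x - x)"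
  then have neg: "inner y (y - x) + inner (y - x) y < 0"
    by (simp add: y_def inner_commute)
  have "((\<lambda>s. T s y) has_vector_derivative y - x) (at 0 within {0..1})"
    using orbit_derivative[of 0 1 x] by (simp add: T_0 y_def)
  then have "((\<lambda>s. inner (T s y) (T s y)) has_real_derivative (inner y (y - x) + inner (y - x) y))
      (at 0 within {0..1})"
    unfolding has_real_derivative_iff_has_vector_derivative
    using bounded_bilinear.has_vector_derivative[OF bounded_bilinear_inner] T_0 by fastforce
  from has_real_derivative_neg_dec_right[OF this neg] obtain d where d: "d > 0"
    "\<And>h. \<lbrakk>0 < h; h \<in> {0..1}; h < d\<rbrakk> \<Longrightarrow> inner (T h y) (T h y) < inner y y"
    by (auto simp: T_0)
  have "inner (T (min 1 (d / 2)) y) (T (min 1 (d / 2)) y) < inner y y"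
    using d(1) by (intro d(2)) auto
  then have "norm (T (min 1 (d / 2)) y) < norm y"
    by (simp add: norm_lt)
  then show False using expansive[of "min 1 (d / 2)" y] d(1) by simp
qed

end

section \<open>The cogenerator and its eigenfunctionals\<close>

context expansive_semigroup
begin

text \<open>The Cayley transform \<open>(A + 1) (A - 1)\<^sup>-\<^sup>1\<close> of the generator \<open>A\<close>.\<close>

definition cogenerator :: "'a \<Rightarrow> 'a" where
  "cogenerator x = x - 2 *\<^sub>R resolvent x"

lemma cogenerator_clinear: "bounded_clinear cogenerator"
  using bounded_clinear_diff[OF bounded_clinear_id bounded_clinear_scaleC[OF resolvent_clinear, of 2]]
  by (simp add: cogenerator_def[abs_def] scaleR_scaleC)

lemma cogenerator_expansive: "norm x \<le> norm (cogenerator x)"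
proof -
  have "inner (cogenerator x) (cogenerator x) - inner x x = 4 * inner (resolvent x) (resolvent x - x)"
    by (simp add: cogenerator_def inner_diff inner_commute)
  then show ?thesis using resolvent_accretive[of x] by (simp add: norm_le)
qed

end

locale cogenerator_left_inverse = expansive_semigroup +
  fixes L :: "'a \<Rightarrow> 'a"
  assumes L_clinear: "bounded_clinear L" and L_contraction: "norm (L x) \<le> norm x"
    and L_left_inverse: "L (cogenerator x) = x"
begin

lemmas L_simps = bounded_clinearD[OF L_clinear]
lemmas cogenerator_simps = bounded_clinearD[OF cogenerator_clinear]

definition pencil_inverse :: "complex \<Rightarrow> 'a \<Rightarrow> 'a" where
  "pencil_inverse z = neumann (\<lambda>x. z *\<^sub>C L x)"

lemma L_powers:
  assumes "cmod z < 1"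
  shows "geometric_powers (\<lambda>x. z *\<^sub>C L x) 1 (cmod z)"
proof
  show "norm (((\<lambda>x. z *\<^sub>C L x) ^^ n) x) \<le> 1 * cmod z ^ n * norm x" for n x
  proof (induction n)
    case (Suc n)
    have "norm (z *\<^sub>C L (((\<lambda>x. z *\<^sub>C L x) ^^ n) x)) \<le> cmod z * norm (((\<lambda>x. z *\<^sub>C L x) ^^ n) x)"
      by (simp add: norm_scaleC L_contraction mult_left_mono)
    also have "\<dots> \<le> cmod z * (1 * cmod z ^ n * norm x)"
      by (intro mult_left_mono Suc.IH) simp
    finally show ?case by (simp add: mult_ac)
  qed simp
qed (simp_all add: assms bounded_clinear_scaleC L_clinear)

lemma L_pencil_inverse: "cmod z < 1 \<Longrightarrow> z *\<^sub>C L (pencil_inverse z x) = pencil_inverse z x - x"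
  unfolding pencil_inverse_def by (rule geometric_powers.apply_neumann[OF L_powers])

lemma pencil_inverse_unique: "\<lbrakk>cmod z < 1; y - z *\<^sub>C L y = x\<rbrakk> \<Longrightarrow> pencil_inverse z x = y"
  unfolding pencil_inverse_def by (rule geometric_powers.neumann_unique[OF L_powers])

lemma pencil_inverse_clinear: "cmod z < 1 \<Longrightarrow> bounded_clinear (pencil_inverse z)"
  unfolding pencil_inverse_def by (rule geometric_powers.bounded_clinear_neumann[OF L_powers])

lemma norm_pencil_inverse: "cmod z < 1 \<Longrightarrow> norm (pencil_inverse z x) \<le> 1 / (1 - cmod z) * norm x"
  unfolding pencil_inverse_def by (rule geometric_powers.norm_neumann[OF L_powers])

lemma pencil_inverse_resolvent_identity:
  assumes "cmod w < 1" "cmod z < 1"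
  shows "pencil_inverse w x - pencil_inverse z x = (w - z) *\<^sub>C pencil_inverse w (L (pencil_inverse z x))"
proof -
  have "pencil_inverse w ((w - z) *\<^sub>C L (pencil_inverse z x)) = pencil_inverse w x - pencil_inverse z x"
    using assms
    by (intro pencil_inverse_unique)
       (simp_all add: L_simps L_pencil_inverse complex_vector.scale_right_diff_distrib complex_vector.scale_left_diff_distrib)
  then show ?thesis by (simp add: bounded_clinearD(2)[OF pencil_inverse_clinear[OF assms(1)]])
qed

lemma pencil_inverse_tendsto:
  assumes z: "cmod z < 1"
  shows "((\<lambda>w. pencil_inverse w x) \<longlongrightarrow> pencil_inverse z x) (at z)"
proof -
  have near: "eventually (\<lambda>w. cmod w < 1) (at z)"
    using order_tendstoD(2)[OF tendsto_norm[OF tendsto_ident_at] z] .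
  have "((\<lambda>w. pencil_inverse w x - pencil_inverse z x) \<longlongrightarrow> 0) (at z)"
  proof (rule Lim_null_comparison)
    show "eventually (\<lambda>w. norm (pencil_inverse w x - pencil_inverse z x) \<le> cmod (w - z) * (1 / (1 - cmod w) * norm (L (pencil_inverse z x)))) (at z)"
      using near
    proof eventually_elim
      case (elim w)
      show ?case
        unfolding pencil_inverse_resolvent_identity[OF elim z] norm_scaleC
        by (intro mult_left_mono norm_pencil_inverse elim) simp
    qed
    have "((\<lambda>w. cmod (w - z) * (1 / (1 - cmod w) * norm (L (pencil_inverse z x)))) \<longlongrightarrow>
        cmod (z - z) * (1 / (1 - cmod z) * norm (L (pencil_inverse z x)))) (at z)"
      using z by (intro tendsto_intros) auto
    then show "((\<lambda>w. cmod (w - z) * (1 / (1 - cmod w) * norm (L (pencil_inverse z x)))) \<longlongrightarrow> 0) (at z)" by simp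
  qed
  then show ?thesis by (simp add: Lim_null[symmetric])
qed

text \<open>
  With \<open>V\<close> the cogenerator, \<open>eval z\<close> is \<open>(1 - V L) (1 - z L)\<^sup>-\<^sup>1 = \<Sum>\<^sub>n z\<^sup>n (1 - V L) L\<^sup>n\<close>: since \<open>1 - V L\<close>
  vanishes on the range of \<open>V\<close>, composing with \<open>V\<close> shifts the series by one place.
\<close>

definition eval :: "complex \<Rightarrow> 'a \<Rightarrow> 'a" where
  "eval z x = pencil_inverse z x - cogenerator (L (pencil_inverse z x))"

lemma eval_clinear: "cmod z < 1 \<Longrightarrow> bounded_clinear (eval z)"
  unfolding eval_def
  by (intro bounded_clinear_diff pencil_inverse_clinear bounded_clinear_compose[OF cogenerator_clinear]
      bounded_clinear_compose[OF L_clinear])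

lemma eval_cogenerator:
  assumes z: "cmod z < 1"
  shows "eval z (cogenerator x) = z *\<^sub>C eval z x"
proof -
  have N_V: "pencil_inverse z (cogenerator x) = cogenerator x + z *\<^sub>C pencil_inverse z x"
    by (rule pencil_inverse_unique[OF z])
       (simp add: L_simps L_left_inverse L_pencil_inverse[OF z] complex_vector.scale_right_diff_distrib scaleC_add_right)
  have "z *\<^sub>C cogenerator (L (pencil_inverse z x)) = cogenerator (pencil_inverse z x) - cogenerator x"
    by (simp add: L_pencil_inverse[OF z] cogenerator_simps(4) flip: cogenerator_simps(2))
  then show ?thesis
    unfolding eval_def N_V
    by (simp add: L_simps cogenerator_simps L_left_inverse L_pencil_inverse[OF z]
        complex_vector.scale_right_diff_distrib)
qed

lemma eval_resolvent:
  assumes z: "cmod z < 1"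
  shows "eval z (resolvent x) = ((1 - z) / 2) *\<^sub>C eval z x"
proof -
  have "resolvent x = (1 / 2) *\<^sub>C (x - cogenerator x)"
    using scaleR_scaleC[of "1/2" "2 *\<^sub>R resolvent x"] by (simp add: cogenerator_def)
  then show ?thesis
    using bounded_clinearD[OF eval_clinear[OF z]] eval_cogenerator[OF z]
      complex_vector.scale_left_diff_distrib[of 1 z "eval z x"]
    by (simp add: scaleC_scaleC[symmetric] diff_divide_distrib complex_vector.scale_left_diff_distrib
        complex_vector.scale_right_diff_distrib)
qed

text \<open>
  On the domain of the generator the orbit is differentiable. There the eigenvalue equation
  for the resolvent turns \<open>t \<mapsto> eval z (T t (resolvent x))\<close> into a solution of \<open>f' = c f\<close> with
  \<open>c = 1 - 2 / (1 - z)\<close>.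
\<close>

lemma eval_semigroup:
  assumes z: "cmod z < 1" and t: "0 \<le> t"
  shows "eval z (T t x) = exp (t * ((z + 1) / (z - 1))) *\<^sub>C eval z x"
proof -
  note ev = bounded_clinearD[OF eval_clinear[OF z]]
  define c where "c = (z + 1) / (z - 1)"
  have z1: "z \<noteq> 1" using z by auto
  have c: "((1 - z) / 2 - 1) = c * ((1 - z) / 2)"
    using z1 by (simp add: c_def field_simps)
  define f where "f s = eval z (T s (resolvent x))" for s
  define g where "g s = exp (- c * of_real s) *\<^sub>C f s" for s
  have "(g has_vector_derivative 0) (at s within {0..t})" if s: "s \<in> {0..t}" for s
  proof -
    have "(f has_vector_derivative eval z (T s (resolvent x - x))) (at s within {0..t})"
      unfolding f_def
      using bounded_linear.has_vector_derivative[OF ev(1) orbit_derivative[OF s]] .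
    moreover have "eval z (T s (resolvent x - x)) = ((1 - z) / 2 - 1) *\<^sub>C eval z (T s x)"
      using s complex_vector.scale_left_diff_distrib[of "(1 - z) / 2" 1 "eval z (T s x)"]
      by (simp add: T_simps ev resolvent_commute[symmetric] eval_resolvent[OF z])
    then have "eval z (T s (resolvent x - x)) = c *\<^sub>C f s"
      using s unfolding c
      by (simp add: f_def resolvent_commute[symmetric] eval_resolvent[OF z] scaleC_scaleC)
    moreover have "((\<lambda>s. exp (- c * of_real s)) has_vector_derivative - c * exp (- c * of_real s))
        (at s within {0..t})"
      by (rule has_vector_derivative_real_field) (auto intro!: derivative_eq_intros)
    ultimately have "(g has_vector_derivative
        exp (- c * of_real s) *\<^sub>C (c *\<^sub>C f s) + (- c * exp (- c * of_real s)) *\<^sub>C f s) (at s within {0..t})"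
      unfolding g_def
      using bounded_bilinear.has_vector_derivative[OF bounded_bilinear_scaleC] by fastforce
    then show ?thesis
      by (simp add: scaleC_scaleC mult.commute complex_vector.scale_minus_left)
  qed
  then have "g t = g 0"
    using has_derivative_zero_unique[of "{0..t}" g t 0] t
    by (auto simp: has_vector_derivative_def)
  then have "exp (c * of_real t) *\<^sub>C g t = exp (c * of_real t) *\<^sub>C g 0" by simp
  then have "f t = exp (c * of_real t) *\<^sub>C f 0"
    by (simp add: g_def scaleC_scaleC flip: exp_add)
  then have "((1 - z) / 2) *\<^sub>C eval z (T t x) = ((1 - z) / 2) *\<^sub>C (exp (c * of_real t) *\<^sub>C eval z x)"
    using t by (simp add: f_def T_0 resolvent_commute[symmetric] eval_resolvent[OF z] scaleC_scaleC mult.commute)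
  moreover have "(1 - z) / 2 \<noteq> 0" using z1 by simp
  ultimately have "eval z (T t x) = exp (c * of_real t) *\<^sub>C eval z x"
    using complex_vector.scale_cancel_left by blast
  then show ?thesis by (simp add: c_def mult.commute)
qed

lemma eval_tendsto:
  assumes "cmod z < 1"
  shows "((\<lambda>w. eval w x) \<longlongrightarrow> eval z x) (at z)"
  unfolding eval_def
  by (intro tendsto_diff pencil_inverse_tendsto[OF assms] bounded_linear.tendsto[OF cogenerator_simps(1)]
      bounded_linear.tendsto[OF L_simps(1)])

lemma eval_derivative:
  assumes z: "cmod z < 1"
  shows "((\<lambda>w. inverse (w - z) *\<^sub>C (eval w x - eval z x)) \<longlongrightarrow> eval z (L (pencil_inverse z x))) (at z)"
proof (rule Lim_transform_eventually[OF eval_tendsto[OF z]])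
  have "eventually (\<lambda>w. cmod w < 1 \<and> w \<noteq> z) (at z)"
    using order_tendstoD(2)[OF tendsto_norm[OF tendsto_ident_at] z]
    by (simp add: eventually_conj_iff eventually_neq_at_within)
  then show "eventually (\<lambda>w. eval w (L (pencil_inverse z x)) = inverse (w - z) *\<^sub>C (eval w x - eval z x)) (at z)"
  proof eventually_elim
    case (elim w)
    let ?y = "pencil_inverse w (L (pencil_inverse z x))"
    have N: "pencil_inverse w x = pencil_inverse z x + (w - z) *\<^sub>C ?y"
      using pencil_inverse_resolvent_identity[of w z x] elim z by (simp add: algebra_simps)
    have "eval w x - eval z x = (w - z) *\<^sub>C eval w (L (pencil_inverse z x))"
      unfolding eval_def N by (simp add: L_simps cogenerator_simps complex_vector.scale_right_diff_distrib)
    then show ?case using elim by (simp add: scaleC_scaleC)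
  qed
qed

section \<open>The eigenfunctionals separate points\<close>

definition joint_kernel :: "'a set" where
  "joint_kernel = {x. \<forall>z. cmod z < 1 \<longrightarrow> eval z x = 0}"

lemma joint_kernel_resolvent: "x \<in> joint_kernel \<Longrightarrow> resolvent x \<in> joint_kernel"
  by (simp add: joint_kernel_def eval_resolvent)

lemma joint_kernel_scaleR: "x \<in> joint_kernel \<Longrightarrow> r *\<^sub>R x \<in> joint_kernel"
  by (simp add: joint_kernel_def bounded_clinearD(5)[OF eval_clinear])

text \<open>
  If \<open>eval q x = 0\<close>, then \<open>x\<close> is divisible by \<open>V - q\<close>. The quotient is again annihilated: by the
  eigenvalue equation for points other than \<open>q\<close>, and by continuity for \<open>q\<close> itself.
\<close>

lemma joint_kernel_division:
  assumes x: "x \<in> joint_kernel" and q: "cmod q < 1"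
  shows "\<exists>u\<in>joint_kernel. cogenerator u - q *\<^sub>C u = x"
proof
  let ?u = "L (pencil_inverse q x)"
  have "cogenerator ?u = pencil_inverse q x"
    using x q by (simp add: joint_kernel_def eval_def)
  then show eq: "cogenerator ?u - q *\<^sub>C ?u = x" by (simp add: L_pencil_inverse[OF q])
  have off: "eval z ?u = 0" if z: "cmod z < 1" "z \<noteq> q" for z
  proof -
    have "(z - q) *\<^sub>C eval z ?u = eval z (cogenerator ?u - q *\<^sub>C ?u)"
      using bounded_clinearD[OF eval_clinear[OF z(1)]] eval_cogenerator[OF z(1)]
      by (simp add: complex_vector.scale_left_diff_distrib)
    also have "\<dots> = 0" using x z by (simp add: eq joint_kernel_def)
    finally show ?thesis using z(2) by simp
  qed
  have "eventually (\<lambda>w. eval w ?u = 0) (at q)"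
    using order_tendstoD(2)[OF tendsto_norm[OF tendsto_ident_at] q] eventually_neq_at_within
    by eventually_elim (use off in auto)
  then have "((\<lambda>w. eval w ?u) \<longlongrightarrow> 0) (at q)" by (rule tendsto_eventually)
  then have "eval q ?u = 0"
    using eval_tendsto[OF q, of ?u] tendsto_unique trivial_limit_at by blast
  then show "?u \<in> joint_kernel" using off by (auto simp: joint_kernel_def)
qed

text \<open>
  One backward Euler step for the inverse semigroup. With \<open>A\<close> the generator, \<open>resolvent g\<close> solves
  \<open>(1 + h A) y = x\<close>. This is division by \<open>V - q\<close> because \<open>1 + h A\<close> is a multiple of \<open>(V - q) (A - 1)\<close>.
\<close>

lemma joint_kernel_backward_step:
  assumes x: "x \<in> joint_kernel" and h: "0 < h" "h < 1"
  shows "\<exists>g. resolvent g \<in> joint_kernel \<and> x = (1 + h) *\<^sub>R resolvent g - h *\<^sub>R g \<and> norm (resolvent g) \<le> norm x"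
proof -
  define q where "q = (1 - h) / (1 + h)"
  have "\<bar>q\<bar> < 1" using h by (simp add: q_def)
  then obtain u where u: "u \<in> joint_kernel" "cogenerator u - complex_of_real q *\<^sub>C u = x"
    using joint_kernel_division[OF x, of "complex_of_real q"] by auto
  \<comment> \<open>The factor comes from \<open>(1 + h) R - h = - (1 + h) / 2 (V - q)\<close>, where \<open>R\<close> is the resolvent.\<close>
  define g where "g = (- 2 / (1 + h)) *\<^sub>R u"
  have "x = (1 - q) *\<^sub>R u - 2 *\<^sub>R resolvent u"
    by (simp add: cogenerator_def algebra_simps flip: u(2) scaleR_scaleC)
  also have "1 - q = 2 * h / (1 + h)" using h by (simp add: q_def field_simps)
  finally have eq: "x = (1 + h) *\<^sub>R resolvent g - h *\<^sub>R g"
    using h resolvent_simps(5)[of "- 2 / (1 + h)" u, folded g_def]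
    by (simp add: g_def mult.commute) (simp add: field_simps)
  have expand: "inner (a + h *\<^sub>R d) (a + h *\<^sub>R d) = inner a a + 2 * h * inner a d + h\<^sup>2 * inner d d"
    for a d :: 'a
    by (simp add: inner_add inner_commute power2_eq_square algebra_simps)
  have "x = resolvent g + h *\<^sub>R (resolvent g - g)"
    by (simp add: eq algebra_simps)
  then have "inner x x = inner (resolvent g) (resolvent g)
      + 2 * h * inner (resolvent g) (resolvent g - g) + h\<^sup>2 * inner (resolvent g - g) (resolvent g - g)"
    using expand by metis
  moreover have "0 \<le> 2 * h * inner (resolvent g) (resolvent g - g)"
    using resolvent_accretive h by simp
  moreover have "0 \<le> h\<^sup>2 * inner (resolvent g - g) (resolvent g - g)" by simp
  ultimately have "norm (resolvent g) \<le> norm x"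
    unfolding norm_le by linarith
  moreover have "resolvent g \<in> joint_kernel"
    unfolding g_def by (intro joint_kernel_resolvent joint_kernel_scaleR u(1))
  ultimately show ?thesis using eq by blast
qed

lemma orbit_lipschitz: "\<exists>C\<ge>0. \<forall>h\<in>{0..1}. \<forall>x. norm (T h (resolvent x) - resolvent x) \<le> C * h * norm x"
proof -
  obtain K where K: "K > 0" "\<And>x. norm (T 1 x) \<le> K * norm x"
    using bounded_clinear_bound[OF T_clinear[of 1]] by auto
  obtain K' where K': "K' > 0" "\<And>x. norm (resolvent x) \<le> K' * norm x"
    using bounded_clinear_bound[OF resolvent_clinear] by auto
  have "norm (T h (resolvent x) - resolvent x) \<le> ((K + 2) * (K' + 1)) * h * norm x" if h: "h \<in> {0..1}" for h x
  proof -
    let ?y = "resolvent x - x"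
    have "norm (T s ?y - T 0 ?y) \<le> (K + 1) * norm ?y" if "s \<in> {0..h}" for s
    proof -
      have "norm (T s ?y) \<le> norm (T 1 ?y)" using that h by (intro norm_T_mono) auto
      then show ?thesis
        using K(2)[of ?y] norm_triangle_ineq4[of "T s ?y" ?y] by (simp add: T_0 distrib_right)
    qed
    then have "norm (T h (resolvent x) - T 0 (resolvent x) - (h - 0) *\<^sub>R T 0 ?y)
        \<le> norm (h - 0) * ((K + 1) * norm ?y)"
      using h by (intro vector_differentiable_bound_linearization[where S = "{0..h}"] orbit_derivative)
        (auto simp: closed_segment_eq_real_ivl)
    then have "norm (T h (resolvent x) - resolvent x - h *\<^sub>R ?y) \<le> h * ((K + 1) * norm ?y)"
      using h by (simp add: T_0)
    then have "norm (T h (resolvent x) - resolvent x) \<le> h * ((K + 1) * norm ?y) + norm (h *\<^sub>R ?y)"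
      using norm_triangle_sub[of "T h (resolvent x) - resolvent x" "h *\<^sub>R ?y"] by linarith
    also have "\<dots> = h * (K + 2) * norm ?y" using h by (simp add: distrib_left distrib_right mult.assoc)
    also have "\<dots> \<le> h * (K + 2) * ((K' + 1) * norm x)"
      using h K(1) K'(2)[of x] norm_triangle_ineq4[of "resolvent x" x]
      by (intro mult_left_mono) (auto simp: distrib_right)
    finally show ?thesis by (simp add: mult_ac)
  qed
  then show ?thesis using K(1) K'(1) by (intro exI[of _ "(K + 2) * (K' + 1)"]) auto
qed

text \<open>
  The local error of the Euler scheme is of second order on the domain of the square of the generator,
  because the derivative of the orbit is again Lipschitz there.
\<close>

lemma orbit_taylor:
  "\<exists>C\<ge>0. \<forall>h\<in>{0..1}. \<forall>x. norm (T h (resolvent (resolvent x)) - resolvent (resolvent x)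
      - h *\<^sub>R (resolvent (resolvent x) - resolvent x)) \<le> C * h\<^sup>2 * norm x"
proof -
  obtain C where C: "C \<ge> 0" "\<And>h x. h \<in> {0..1} \<Longrightarrow> norm (T h (resolvent x) - resolvent x) \<le> C * h * norm x"
    using orbit_lipschitz by blast
  obtain K' where K': "K' > 0" "\<And>x. norm (resolvent x) \<le> K' * norm x"
    using bounded_clinear_bound[OF resolvent_clinear] by auto
  have "norm (T h (resolvent (resolvent x)) - resolvent (resolvent x)
      - h *\<^sub>R (resolvent (resolvent x) - resolvent x)) \<le> (C * (K' + 1)) * h\<^sup>2 * norm x"
    if h: "h \<in> {0..1}" for h x
  proof -
    let ?R = resolvent
    let ?y = "?R (?R x) - ?R x"
    have y: "?y = ?R (?R x - x)" by (simp add: resolvent_simps)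
    have "norm (T s ?y - T 0 ?y) \<le> C * h * norm (?R x - x)" if "s \<in> {0..h}" for s
    proof -
      have "norm (T s ?y - T 0 ?y) \<le> C * s * norm (?R x - x)"
        unfolding y T_0 using that h by (intro C(2)) auto
      also have "\<dots> \<le> C * h * norm (?R x - x)"
        using that C(1) by (intro mult_right_mono mult_left_mono) auto
      finally show ?thesis .
    qed
    then have "norm (T h (?R (?R x)) - T 0 (?R (?R x)) - (h - 0) *\<^sub>R T 0 ?y)
        \<le> norm (h - 0) * (C * h * norm (?R x - x))"
      using h by (intro vector_differentiable_bound_linearization[where S = "{0..h}"] orbit_derivative)
        (auto simp: closed_segment_eq_real_ivl)
    then have "norm (T h (?R (?R x)) - ?R (?R x) - h *\<^sub>R ?y) \<le> h * (C * h * norm (?R x - x))"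
      using h by (simp add: T_0)
    also have "\<dots> \<le> h * (C * h * ((K' + 1) * norm x))"
      using h C(1) K'(2)[of x] norm_triangle_ineq4[of "?R x" x]
      by (intro mult_left_mono) (auto simp: distrib_right)
    finally show ?thesis by (simp add: power2_eq_square mult_ac)
  qed
  then show ?thesis using C(1) K'(1) by (intro exI[of _ "C * (K' + 1)"]) auto
qed

lemma closed_range_T:
  assumes "0 \<le> t"
  shows "closed (range (T t))"
proof (rule complete_imp_closed, rule complete_isometric_image[where e = 1])
  show "bounded_linear (T t)" by (rule bounded_clinearD(1)[OF T_clinear[OF assms]])
qed (use expansive[OF assms] complete_UNIV in auto)

text \<open>
  On the joint kernel the semigroup can be run backwards: \<open>n\<close> backward Euler steps of size \<open>t / n\<close>
  from \<open>x\<close> stay bounded, and \<open>T t\<close> undoes them up to an error of order \<open>1 / n\<close>. Applying the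
  resolvent twice supplies the smoothness for the Taylor estimate; the range of \<open>T t\<close> is closed.
\<close>

lemma joint_kernel_subset_range:
  assumes x: "x \<in> joint_kernel" and t: "0 < t"
  shows "resolvent (resolvent x) \<in> range (T t)"
proof -
  let ?R2 = "\<lambda>x. resolvent (resolvent x)"
  obtain C where C: "C \<ge> 0" "\<And>h x. h \<in> {0..1} \<Longrightarrow>
      norm (T h (?R2 x) - ?R2 x - h *\<^sub>R (?R2 x - resolvent x)) \<le> C * h\<^sup>2 * norm x"
    using orbit_taylor by blast
  obtain K where K: "K > 0" "\<And>x. norm (T t x) \<le> K * norm x"
    using bounded_clinear_bound[OF T_clinear] t by (metis less_imp_le)
  have approx: "\<exists>y. norm (T t y - ?R2 x) \<le> K * C * t\<^sup>2 * norm x / n" if n: "t < real n" for n :: nat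
  proof -
    define h where "h = t / n"
    have h: "0 < h" "h < 1" "n * h = t" using n t by (simp_all add: h_def)
    have "\<exists>w. \<forall>k. (w k \<in> joint_kernel \<and> norm (w k) \<le> norm x \<and> (k = 0 \<longrightarrow> w k = x)) \<and>
        (\<exists>g. w (Suc k) = resolvent g \<and> w k = (1 + h) *\<^sub>R resolvent g - h *\<^sub>R g)"
    proof (rule dependent_nat_choice)
      show "\<exists>w. w \<in> joint_kernel \<and> norm w \<le> norm x \<and> (0 = (0::nat) \<longrightarrow> w = x)" using x by auto
      fix w and k :: nat
      assume "w \<in> joint_kernel \<and> norm w \<le> norm x \<and> (k = 0 \<longrightarrow> w = x)"
      then show "\<exists>w'. (w' \<in> joint_kernel \<and> norm w' \<le> norm x \<and> (Suc k = 0 \<longrightarrow> w' = x)) \<and>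
          (\<exists>g. w' = resolvent g \<and> w = (1 + h) *\<^sub>R resolvent g - h *\<^sub>R g)"
        using joint_kernel_backward_step[of w h] h(1,2) by (metis Suc_neq_Zero order_trans)
    qed
    then obtain w where w0: "w 0 = x" and w_norm: "\<And>k. norm (w k) \<le> norm x"
      and w_step: "\<And>k. \<exists>g. w (Suc k) = resolvent g \<and> w k = (1 + h) *\<^sub>R resolvent g - h *\<^sub>R g"
      by metis
    \<comment> \<open>The operator \<open>T (k h)\<close> approximately undoes \<open>k\<close> steps, and each step adds one local error.\<close>
    have "norm (T (k * h) (?R2 (w k)) - ?R2 x) \<le> k * (K * (C * h\<^sup>2 * norm x))" if "k \<le> n" for k
      using that
    proof (induction k)
      case 0
      then show ?case by (simp add: T_0 w0)
    next
      case (Suc k)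
      obtain g where g: "w (Suc k) = resolvent g" "w k = (1 + h) *\<^sub>R resolvent g - h *\<^sub>R g"
        using w_step by blast
      let ?w = "w (Suc k)"
      have kh: "0 \<le> k * h" "k * h \<le> t"
        using h Suc.prems mult_right_mono[of "real k" "real n" h] by auto
      have R2: "?R2 (w k) = ?R2 ?w + h *\<^sub>R (?R2 ?w - resolvent ?w)"
        unfolding g by (simp add: resolvent_simps algebra_simps)
      have "T (real (Suc k) * h) (?R2 ?w) - T (k * h) (?R2 (w k)) = T (k * h) (T h (?R2 ?w) - ?R2 (w k))"
        using T_add[of "k * h" h] kh h by (simp add: T_simps distrib_right add.commute)
      also have "norm \<dots> \<le> norm (T t (T h (?R2 ?w) - ?R2 (w k)))"
        by (rule norm_T_mono[OF kh])
      also have "\<dots> \<le> K * norm (T h (?R2 ?w) - ?R2 (w k))" by (rule K(2))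
      also have "norm (T h (?R2 ?w) - ?R2 (w k)) \<le> C * h\<^sup>2 * norm ?w"
        using C(2)[of h ?w] h by (simp add: R2 diff_diff_add)
      also have "C * h\<^sup>2 * norm ?w \<le> C * h\<^sup>2 * norm x"
        using C(1) by (intro mult_left_mono w_norm) auto
      finally have "norm (T (real (Suc k) * h) (?R2 ?w) - T (k * h) (?R2 (w k))) \<le> K * (C * h\<^sup>2 * norm x)"
        using K(1) by simp
      then have "norm (T (real (Suc k) * h) (?R2 ?w) - ?R2 x)
          \<le> K * (C * h\<^sup>2 * norm x) + k * (K * (C * h\<^sup>2 * norm x))"
        using Suc norm_triangle_ineq[of "T (real (Suc k) * h) (?R2 ?w) - T (k * h) (?R2 (w k))"
            "T (k * h) (?R2 (w k)) - ?R2 x"] by simp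
      then show ?case by (simp add: algebra_simps)
    qed
    from this[of n] have "norm (T t (?R2 (w n)) - ?R2 x) \<le> n * (K * (C * h\<^sup>2 * norm x))"
      using h(3) by simp
    also have "\<dots> = K * C * t\<^sup>2 * norm x / n"
      using n t by (simp add: h_def power2_eq_square)
    finally show ?thesis by blast
  qed
  have "?R2 x \<in> closure (range (T t))"
    unfolding closure_approachable
  proof (intro allI impI)
    fix e :: real assume e: "0 < e"
    obtain n :: nat where n: "max t (K * C * t\<^sup>2 * norm x / e) < n"
      using reals_Archimedean2 by blast
    then have pos: "0 < real n" and less: "K * C * t\<^sup>2 * norm x / n < e"
      using t e by (auto simp: field_simps)
    obtain y where "norm (T t y - ?R2 x) \<le> K * C * t\<^sup>2 * norm x / n"
      using approx[of n] n by auto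
    then show "\<exists>y\<in>range (T t). dist y (?R2 x) < e"
      using less by (auto simp: dist_norm intro!: exI[of _ y])
  qed
  then show ?thesis
    using closed_range_T[of t] t by (simp add: closure_closed)
qed

lemma joint_kernel_trivial:
  assumes pure: "pure_op (T 1)" and x: "x \<in> joint_kernel"
  shows "x = 0"
proof -
  have "resolvent (resolvent x) \<in> range (T 1 ^^ n)" for n
  proof (cases "n = 0")
    case False
    have "(T 1 ^^ n) = T (real n)" using T_power[of 1 n] by (simp add: fun_eq_iff)
    then show ?thesis using joint_kernel_subset_range[OF x, of "real n"] False by simp
  qed simp
  then have "resolvent (resolvent x) \<in> {0}"
    using pure unfolding pure_op_def by blast
  then show ?thesis using resolvent_injective by blast
qed

end

section \<open>Hilbert spaces with an explicit carrier\<close>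

text \<open>
  Transport of structure along an injective map. The inverse of \<open>U\<close> is applied to arguments outside the
  range as well: a metric has to be symmetric and nonnegative on the whole type, not just on its carrier,
  and this choice makes the distance of any two arguments that of two vectors.
\<close>

definition transported :: "('a::complex_hilbert \<Rightarrow> 'v) \<Rightarrow> 'v inner_module" where
  "transported U = \<lparr>carrier = range U, mult = undefined, one = undefined, zero = U 0,
     add = (\<lambda>x y. U (inv_into UNIV U x + inv_into UNIV U y)),
     smult = (\<lambda>c x. U (c *\<^sub>C inv_into UNIV U x)),
     ip = (\<lambda>x y. cinner (inv_into UNIV U x) (inv_into UNIV U y))\<rparr>"

lemma transported_sel:
  "carrier (transported U) = range U" "\<zero>\<^bsub>transported U\<^esub> = U 0"
  "x \<oplus>\<^bsub>transported U\<^esub> y = U (inv_into UNIV U x + inv_into UNIV U y)"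
  "c \<odot>\<^bsub>transported U\<^esub> x = U (c *\<^sub>C inv_into UNIV U x)"
  "ip (transported U) x y = cinner (inv_into UNIV U x) (inv_into UNIV U y)"
  by (simp_all add: transported_def)

lemma unitary_onto_transported: "inj U \<Longrightarrow> unitary_onto (transported U) U"
  by (simp add: unitary_onto_def transported_sel bij_betw_def)

lemma ip_norm_transported: "ip_norm (transported U) x = norm (inv_into UNIV U x)"
  by (simp add: ip_norm_def transported_sel norm_eq_sqrt_inner inner_eq_Re_cinner)

lemma minus_transported:
  assumes inj: "inj U"
  shows "x \<ominus>\<^bsub>transported U\<^esub> y = U (inv_into UNIV U x - inv_into UNIV U y)"
proof -
  have "(THE z. z \<in> range U \<and> U (inv_into UNIV U y + inv_into UNIV U z) = U 0 \<and>
      U (inv_into UNIV U z + inv_into UNIV U y) = U 0) = U (- inv_into UNIV U y)"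
  proof (rule the_equality)
    fix z assume "z \<in> range U \<and> U (inv_into UNIV U y + inv_into UNIV U z) = U 0 \<and>
      U (inv_into UNIV U z + inv_into UNIV U y) = U 0"
    then obtain a where "z = U a" "a + inv_into UNIV U y = 0" by (auto simp: inj inj_eq[OF inj])
    then show "z = U (- inv_into UNIV U y)" by (simp add: inj_eq[OF inj] eq_neg_iff_add_eq_0)
  qed (simp add: inj)
  then have "\<ominus>\<^bsub>transported U\<^esub> y = U (- inv_into UNIV U y)"
    by (simp add: a_inv_def m_inv_def transported_sel)
  then show ?thesis by (simp add: a_minus_def transported_sel inj)
qed

lemma hilbert_space_transported:
  fixes U :: "'a::complex_hilbert \<Rightarrow> 'v"
  assumes inj: "inj U"
  shows "hilbert_space (transported U)"
proof -
  have "abelian_group (transported U)"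
  proof (rule abelian_groupI)
    show "\<exists>y\<in>carrier (transported U). y \<oplus>\<^bsub>transported U\<^esub> x = \<zero>\<^bsub>transported U\<^esub>" for x
      by (rule bexI[of _ "U (- inv_into UNIV U x)"]) (simp_all add: transported_sel inj)
  qed (auto simp: transported_sel inj add_ac)
  then have module: "Module.module (ring_of_type_algebra :: complex ring) (transported U)"
    by (intro moduleI cring_from_type_algebra)
       (auto simp: transported_sel inj ring_of_type_algebra_def scaleC_add_left scaleC_add_right scaleC_scaleC)
  define d where "d x y = dist (inv_into UNIV U x) (inv_into UNIV U y)" for x y
  have d: "d = (\<lambda>x y. ip_norm (transported U) (x \<ominus>\<^bsub>transported U\<^esub> y))"
    by (simp add: d_def fun_eq_iff ip_norm_transported minus_transported[OF inj] inj dist_norm)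
  interpret metric: Metric_space "range U" d
    by unfold_locales (auto simp: d_def inj dist_commute dist_triangle)
  have "metric.mcomplete"
    unfolding metric.mcomplete_def metric.MCauchy_def
  proof (intro allI impI, elim conjE)
    fix s :: "nat \<Rightarrow> 'v" assume s: "range s \<subseteq> range U"
      and cauchy: "\<forall>e>0. \<exists>N. \<forall>n n'. N \<le> n \<longrightarrow> N \<le> n' \<longrightarrow> d (s n) (s n') < e"
    define x where "x n = inv_into UNIV U (s n)" for n
    have "Cauchy x"
      using cauchy unfolding Cauchy_def d_def x_def by blast
    then obtain l where "x \<longlonglongrightarrow> l" using Cauchy_convergent[of x] unfolding convergent_def by blast
    then have "limitin metric.mtopology s (U l) sequentially"
      using range_subsetD[OF s] by (simp add: metric.limitin_metric d_def x_def inj tendsto_iff)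
    then show "\<exists>l. limitin metric.mtopology s l sequentially" by blast
  qed
  then have "Metric_space.mcomplete (carrier (transported U))
      (\<lambda>x y. ip_norm (transported U) (x \<ominus>\<^bsub>transported U\<^esub> y))"
    by (simp add: transported_sel(1) flip: d)
  moreover have "0 < Re (cinner x x)" if "U x \<noteq> U 0" for x
    using that inner_gt_zero_iff[of x] by (auto simp: inner_eq_Re_cinner)
  ultimately show ?thesis
    by (intro hilbert_space.intro module hilbert_space_axioms.intro)
       (auto simp: transported_sel inj cinner_add_left cinner_scaleC_left intro: cinner_commute)
qed

lemma unitary_onto_norm:
  assumes "unitary_onto V U"
  shows "ip_norm V (U x) = norm x"
  using assms by (simp add: unitary_onto_def ip_norm_def norm_eq_sqrt_inner inner_eq_Re_cinner)

lemma unitary_onto_bounded_operator: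
  assumes U: "unitary_onto V U" and B: "bounded_clinear B" and intertwine: "\<And>x. A (U x) = U (B x)"
  shows "bounded_operator_on V A"
proof -
  have carrier: "carrier V = range U"
    and add: "\<And>x y. U x \<oplus>\<^bsub>V\<^esub> U y = U (x + y)"
    and smult: "\<And>c x. c \<odot>\<^bsub>V\<^esub> U x = U (c *\<^sub>C x)"
    using U by (auto simp: unitary_onto_def bij_betw_def)
  obtain K where "\<And>x. norm (B x) \<le> K * norm x" using bounded_clinear_bound[OF B] by blast
  then show ?thesis
    unfolding bounded_operator_on_def
    by (auto simp: carrier add smult intertwine bounded_clinearD[OF B] unitary_onto_norm[OF U])
qed

definition hilbert_module :: "'a::complex_hilbert inner_module" where
  "hilbert_module = transported (\<lambda>x. x)"

lemma hilbert_module_sel: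
  "carrier hilbert_module = UNIV" "x \<oplus>\<^bsub>hilbert_module\<^esub> y = x + y" "x \<ominus>\<^bsub>hilbert_module\<^esub> y = x - y"
  "c \<odot>\<^bsub>hilbert_module\<^esub> x = c *\<^sub>C x" "ip hilbert_module x y = cinner x y" "ip_norm hilbert_module x = norm x"
proof -
  have "inv_into UNIV (\<lambda>x. x) v = v" for v :: 'a by (rule inv_f_f) simp
  then show "carrier hilbert_module = UNIV" "x \<oplus>\<^bsub>hilbert_module\<^esub> y = x + y" "x \<ominus>\<^bsub>hilbert_module\<^esub> y = x - y"
    "c \<odot>\<^bsub>hilbert_module\<^esub> x = c *\<^sub>C x" "ip hilbert_module x y = cinner x y" "ip_norm hilbert_module x = norm x"
    by (simp_all add: hilbert_module_def transported_sel ip_norm_transported minus_transported)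
qed

lemma bounded_operator_on_hilbert_module:
  assumes "bounded_clinear A"
  shows "bounded_operator_on hilbert_module A"
  unfolding hilbert_module_def
  by (rule unitary_onto_bounded_operator[OF unitary_onto_transported assms]) simp_all

section \<open>Spaces of functions from separating families of operators\<close>

definition coefficient_function :: "complex set \<Rightarrow> (complex \<Rightarrow> 'a \<Rightarrow> 'a) \<Rightarrow> 'a \<Rightarrow> complex \<Rightarrow> 'a" where
  "coefficient_function D ev x = (\<lambda>z\<in>D. ev z x)"

locale separating_family =
  fixes D :: "complex set" and ev :: "complex \<Rightarrow> 'a \<Rightarrow> 'a::complex_hilbert"
  assumes ev: "z \<in> D \<Longrightarrow> bounded_clinear (ev z)"
    and separating: "(\<And>z. z \<in> D \<Longrightarrow> ev z x = 0) \<Longrightarrow> x = 0"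
begin

abbreviation "U \<equiv> coefficient_function D ev"

lemmas ev_simps = ev[THEN bounded_clinearD(2)] ev[THEN bounded_clinearD(3)] ev[THEN bounded_clinearD(4)]

lemma inj_coefficient_function: "inj U"
proof (rule injI)
  fix x y assume eq: "U x = U y"
  have "ev z (x - y) = 0" if "z \<in> D" for z
    using fun_cong[OF eq, of z] that by (simp add: coefficient_function_def ev_simps)
  then show "x = y" using separating[of "x - y"] by simp
qed

text \<open>
  The kernel is \<open>k \<mu> z = ev z (ev \<mu>)\<^sup>*\<close>: the function \<open>k \<mu> \<cdot> e\<close> is the image of \<open>(ev \<mu>)\<^sup>* e\<close>, so pairing
  with it evaluates at \<open>\<mu>\<close>.
\<close>

lemma holomorphic_rkhs_transported:
  assumes D: "open D"
    and derivative: "\<And>z x. z \<in> D \<Longrightarrow>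
      \<exists>d. ((\<lambda>w. inverse (w - z) *\<^sub>C (ev w x - ev z x)) \<longlongrightarrow> d) (at z)"
  shows "holomorphic_rkhs D hilbert_module (transported U)" (is "holomorphic_rkhs D ?E ?F")
proof -
  note inj = inj_coefficient_function
  have "hilbert_space ?F"
    by (rule hilbert_space_transported[OF inj])
  moreover have "carrier ?F \<subseteq> holomorphic_into D ?E"
  proof
    fix f assume "f \<in> carrier ?F"
    then obtain x where f: "f = U x" by (auto simp: transported_sel)
    have "\<exists>d. ((\<lambda>w. norm (inverse (w - z) *\<^sub>C (f w - f z) - d)) \<longlongrightarrow> 0) (at z)" if z: "z \<in> D" for z
    proof -
      obtain d where d: "((\<lambda>w. inverse (w - z) *\<^sub>C (ev w x - ev z x)) \<longlongrightarrow> d) (at z)"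
        using derivative[OF z] by blast
      have "eventually (\<lambda>w. w \<in> D) (at z)" using D z by (rule eventually_at_in_open')
      then have "eventually (\<lambda>w. norm (inverse (w - z) *\<^sub>C (ev w x - ev z x) - d)
          = norm (inverse (w - z) *\<^sub>C (f w - f z) - d)) (at z)"
        by eventually_elim (use z in \<open>simp add: f coefficient_function_def\<close>)
      moreover have "((\<lambda>w. norm (inverse (w - z) *\<^sub>C (ev w x - ev z x) - d)) \<longlongrightarrow> 0) (at z)"
        using d by (intro tendsto_norm_zero LIM_zero)
      ultimately show ?thesis by (intro exI[of _ d]) (rule Lim_transform_eventually)
    qed
    then show "f \<in> holomorphic_into D ?E"
      by (simp add: holomorphic_into_def hilbert_module_sel) (simp add: f coefficient_function_def)
  qed
  moreover have "\<exists>k. reproducing_kernel D ?E ?F k"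
  proof -
    have "\<forall>\<mu>\<in>D. \<exists>B. bounded_clinear B \<and> (\<forall>x y. cinner (ev \<mu> x) y = cinner x (B y))"
      by (intro ballI adjoint_exists ev)
    then obtain B where B: "\<And>\<mu>. \<mu> \<in> D \<Longrightarrow> bounded_clinear (B \<mu>)"
      "\<And>\<mu> x y. \<mu> \<in> D \<Longrightarrow> cinner (ev \<mu> x) y = cinner x (B \<mu> y)" by metis
    have "reproducing_kernel D ?E ?F (\<lambda>\<mu> z e. ev z (B \<mu> e))"
      unfolding reproducing_kernel_def
    proof (intro conjI ballI)
      fix \<mu> z assume "\<mu> \<in> D" "z \<in> D"
      then show "bounded_operator_on ?E (\<lambda>e. ev z (B \<mu> e))"
        by (intro bounded_operator_on_hilbert_module bounded_clinear_compose[OF ev B(1)])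
    next
      fix \<mu> e assume \<mu>: "\<mu> \<in> D"
      have section_eq: "(\<lambda>z\<in>D. ev z (B \<mu> e)) = U (B \<mu> e)"
        by (simp add: coefficient_function_def)
      show "(\<lambda>z\<in>D. ev z (B \<mu> e)) \<in> carrier ?F"
        by (simp add: section_eq transported_sel(1))
      fix f assume "f \<in> carrier ?F"
      then obtain x where f: "f = U x" by (auto simp: transported_sel(1))
      have "ip ?F f (\<lambda>z\<in>D. ev z (B \<mu> e)) = cinner x (B \<mu> e)"
        by (simp add: section_eq f transported_sel(5) inj)
      also have "\<dots> = ip ?E (f \<mu>) e"
        using \<mu> by (simp add: f hilbert_module_sel coefficient_function_def B(2))
      finally show "ip ?F f (\<lambda>z\<in>D. ev z (B \<mu> e)) = ip ?E (f \<mu>) e" .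
    qed
    then show ?thesis by blast
  qed
  moreover have "f \<oplus>\<^bsub>?F\<^esub> g = (\<lambda>z\<in>D. f z \<oplus>\<^bsub>?E\<^esub> g z)" "c \<odot>\<^bsub>?F\<^esub> f = (\<lambda>z\<in>D. c \<odot>\<^bsub>?E\<^esub> f z)"
    if "f \<in> carrier ?F" "g \<in> carrier ?F" for f g c
  proof -
    obtain x y where "f = U x" "g = U y" using \<open>f \<in> carrier ?F\<close> \<open>g \<in> carrier ?F\<close> by (auto simp: transported_sel(1))
    then show "f \<oplus>\<^bsub>?F\<^esub> g = (\<lambda>z\<in>D. f z \<oplus>\<^bsub>?E\<^esub> g z)" "c \<odot>\<^bsub>?F\<^esub> f = (\<lambda>z\<in>D. c \<odot>\<^bsub>?E\<^esub> f z)"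
      using inj by (simp_all add: transported_sel hilbert_module_sel)
        (simp_all add: coefficient_function_def ev_simps fun_eq_iff)
  qed
  ultimately show ?thesis
    unfolding holomorphic_rkhs_def by blast
qed

end

section \<open>The functional model\<close>

theorem theorem4p6:
  fixes T :: "real \<Rightarrow> 'a::complex_hilbert \<Rightarrow> 'a"
  assumes "separable_space (euclidean :: 'a topology)"
    and "infinite_dimensional TYPE('a)"
    and "C0_semigroup T"
    and "\<And>t. t > 0 \<Longrightarrow> pure_op (T t) \<and> concave_op (T t)"
  shows "\<exists>r>0. \<exists>(E :: 'a inner_module) (F :: (complex \<Rightarrow> 'a) inner_module) (U :: 'a \<Rightarrow> complex \<Rightarrow> 'a).
           hilbert_space E \<and>
           holomorphic_rkhs (ball 0 r) E F \<and>
           unitary_onto F U \<and>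
           (\<forall>t\<ge>0. bounded_operator_on F (mult_exp (ball 0 r) E t) \<and>
                   T t = inv_into UNIV U \<circ> mult_exp (ball 0 r) E t \<circ> U)"
proof -
  obtain M where "expansive_semigroup T M"
    using concave_imp_expansive_semigroup assms(3,4) by blast
  then interpret expansive_semigroup T M .
  obtain L where "bounded_clinear L" "\<And>x. norm (L x) \<le> norm x" "\<And>x. L (cogenerator x) = x"
    using contractive_left_inverse_exists[OF cogenerator_clinear cogenerator_expansive] by blast
  then interpret cogenerator_left_inverse T M L
    by unfold_locales
  let ?D = "ball 0 1 :: complex set"
  interpret model: separating_family ?D eval
  proof
    show "bounded_clinear (eval z)" if "z \<in> ?D" for z
      using that by (simp add: eval_clinear)
    show "x = 0" if "\<And>z. z \<in> ?D \<Longrightarrow> eval z x = 0" for x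
      using joint_kernel_trivial[of x] assms(4)[of 1] that by (simp add: joint_kernel_def)
  qed
  let ?U = "coefficient_function ?D eval"
  let ?F = "transported ?U"
  note inj = model.inj_coefficient_function
  note U = unitary_onto_transported[OF inj]
  have rkhs: "holomorphic_rkhs ?D hilbert_module ?F"
    using eval_derivative by (intro model.holomorphic_rkhs_transported) auto
  have intertwine: "mult_exp ?D hilbert_module t (?U x) = ?U (T t x)" if "t \<ge> 0" for t x
    using that
    by (auto simp: coefficient_function_def mult_exp_def hilbert_module_sel eval_semigroup fun_eq_iff)
  have "bounded_operator_on ?F (mult_exp ?D hilbert_module t) \<and>
      T t = inv_into UNIV ?U \<circ> mult_exp ?D hilbert_module t \<circ> ?U" if t: "t \<ge> 0" for t
  proof
    show "bounded_operator_on ?F (mult_exp ?D hilbert_module t)"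
      using unitary_onto_bounded_operator[OF U T_clinear[OF t] intertwine[OF t]] .
    show "T t = inv_into UNIV ?U \<circ> mult_exp ?D hilbert_module t \<circ> ?U"
      by (simp add: fun_eq_iff intertwine[OF t] inv_f_f[OF inj])
  qed
  then show ?thesis
    using hilbert_space_transported[of "\<lambda>x::'a. x", folded hilbert_module_def] rkhs U
    by (intro exI[of _ 1] conjI exI[of _ hilbert_module] exI[of _ ?F] exI[of _ ?U]) auto
qed

end
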